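(* Let $F$ be a Kähler manifold (of real dimension $2n$), let $k$ be a non-zero constant, and let $f(t)=ke^{\sum_{i=1}^s t_i}$ be a function on $\mathbb{R}^s$, $t=(t_1,\dots,t_s)$. Then the warped product space $M=\mathbb{R}^s\times_f F$ carries the structure of a generalized Kenmotsu manifold $(\varphi,\xi_i,\eta^i,g)$ whose metric $g$ is the warped product metric $g_f$.
   Context: Here $n,s\ge 1$. If $(F,J,G)$ is a Kähler manifold, the warped product $\mathbb{R}^s\times_f F$ is $\mathbb{R}^s\times F$ with the metric $g_f=\sum_{i=1}^s dt^i\otimes dt^i+f^2\pi^*(G)$, where $\pi:\mathbb{R}^s\times F\to F$ is the projection. A metric $f$-manifold is a $(2n+s)$-dimensional smooth manifold $M$ with a $(1,1)$-tensor field $\varphi$, vector fields $\xi_1,\dots,\xi_s$, $1$-forms $\eta^1,\dots,\eta^s$ and a Riemannian metric $g$ such that $\varphi^2=-I+\sum_{i=1}^s\eta^i\otimes\xi_i$, $\eta^i(\xi_j)=\delta_{ij}$ and $g(\varphi X,\varphi Y)=g(X,Y)-\sum_{i=1}^s\eta^i(X)\eta^i(Y)$. The fundamental $2$-form is $\Phi(X,Y)=g(X,\varphi Y)$. A metric $f$-manifold is an almost $s$-contact metric manifold if $\eta^1\wedge\dots\wedge\eta^s\wedge\Phi^n\neq 0$ everywhere on $M$. It is normal if $[\varphi,\varphi]+2\sum_{i=1}^s d\eta^i\otimes\xi_i=0$, where $[\varphi,\varphi](X,Y)=\varphi^2[X,Y]+[\varphi X,\varphi Y]-\varphi[\varphi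 X,Y]-\varphi[X,\varphi Y]$ and $2d\eta(X,Y)=X\eta(Y)-Y\eta(X)-\eta([X,Y])$. An almost $s$-contact metric manifold is a generalized almost Kenmotsu manifold if all the $1$-forms $\eta^i$ are closed and $d\Phi=2\sum_{i=1}^s\eta^i\wedge\Phi$; a normal generalized almost Kenmotsu manifold is called a generalized Kenmotsu manifold. *)

theory Defs
  imports "HOL-Analysis.Analysis" "HOL-Combinatorics.Permutations"
begin

section \<open>Smooth manifolds\<close>

text \<open>The set \<open>S\<close> is always open in what follows.  For differentiable maps between Euclidean
  spaces, continuity of all directional derivatives is continuity of the derivative.\<close>

primrec Ck_on :: "nat \<Rightarrow> 'a::euclidean_space set \<Rightarrow> ('a \<Rightarrow> 'b::real_normed_vector) \<Rightarrow> bool" where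
  "Ck_on 0 S f \<longleftrightarrow> continuous_on S f"
| "Ck_on (Suc k) S f \<longleftrightarrow>
     (\<forall>x\<in>S. f differentiable (at x)) \<and> (\<forall>v. Ck_on k S (\<lambda>x. frechet_derivative f (at x) v))"

definition smooth_on :: "'a::euclidean_space set \<Rightarrow> ('a \<Rightarrow> 'b::real_normed_vector) \<Rightarrow> bool" where
  "smooth_on S f \<longleftrightarrow> (\<forall>k. Ck_on k S f)"

record ('m, 'e) chart =
  chart_dom :: "'m set"
  chart_map :: "'m \<Rightarrow> 'e"

definition chart_inv :: "('m, 'e) chart \<Rightarrow> 'e \<Rightarrow> 'm" where
  "chart_inv c = inv_into (chart_dom c) (chart_map c)"

definition is_chart :: "('m::topological_space, 'e::euclidean_space) chart \<Rightarrow> bool" where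
  "is_chart c \<longleftrightarrow> open (chart_dom c) \<and> open (chart_map c ` chart_dom c) \<and>
     homeomorphism (chart_dom c) (chart_map c ` chart_dom c) (chart_map c) (chart_inv c)"

text \<open>The points of a manifold are the elements of the type \<open>'m\<close>, which carries the topology; the
  model space \<open>'e\<close> fixes the dimension.  Besides an atlas, we record a choice of a chart
  \<open>base_chart M p\<close> around every point \<open>p\<close>.  The choice is arbitrary; its only purpose is to
  identify the tangent space at \<open>p\<close> with \<open>'e\<close>: the vector \<open>v :: 'e\<close> at \<open>p\<close> stands for the
  tangent vector whose components in the chart \<open>base_chart M p\<close> are \<open>v\<close>.  Its components in any
  other chart are obtained by the usual transformation rule, see \<open>tangent_coord\<close>.\<close>

record ('m, 'e) manifold =
  atlas :: "('m, 'e) chart set"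
  base_chart :: "'m \<Rightarrow> ('m, 'e) chart"

definition smooth_manifold ::
    "('m::{t2_space,second_countable_topology}, 'e::euclidean_space) manifold \<Rightarrow> bool" where
  "smooth_manifold M \<longleftrightarrow>
     (\<forall>c\<in>atlas M. is_chart c) \<and>
     (\<forall>c\<in>atlas M. \<forall>d\<in>atlas M.
        smooth_on (chart_map c ` (chart_dom c \<inter> chart_dom d)) (chart_map d \<circ> chart_inv c)) \<and>
     (\<forall>p. base_chart M p \<in> atlas M \<and> p \<in> chart_dom (base_chart M p))"

definition euclidean_manifold :: "('e::euclidean_space, 'e) manifold" where
  "euclidean_manifold =
     \<lparr>atlas = {\<lparr>chart_dom = UNIV, chart_map = id\<rparr>},
      base_chart = (\<lambda>_. \<lparr>chart_dom = UNIV, chart_map = id\<rparr>)\<rparr>"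

definition prod_chart :: "('m, 'e) chart \<Rightarrow> ('n, 'f) chart \<Rightarrow> ('m \<times> 'n, 'e \<times> 'f) chart" where
  "prod_chart c d =
     \<lparr>chart_dom = chart_dom c \<times> chart_dom d, chart_map = map_prod (chart_map c) (chart_map d)\<rparr>"

definition prod_manifold ::
    "('m, 'e) manifold \<Rightarrow> ('n, 'f) manifold \<Rightarrow> ('m \<times> 'n, 'e \<times> 'f) manifold" where
  "prod_manifold M N =
     \<lparr>atlas = {prod_chart c d | c d. c \<in> atlas M \<and> d \<in> atlas N},
      base_chart = (\<lambda>(p, q). prod_chart (base_chart M p) (base_chart N q))\<rparr>"


section \<open>Differentials, vector fields and tensor fields\<close>

text \<open>The components in the chart \<open>c\<close> of a tangent vector at \<open>p\<close>.\<close>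

definition tangent_coord ::
    "('m, 'e::euclidean_space) manifold \<Rightarrow> ('m, 'e) chart \<Rightarrow> 'm \<Rightarrow> 'e \<Rightarrow> 'e" where
  "tangent_coord M c p =
     frechet_derivative (chart_map c \<circ> chart_inv (base_chart M p)) (at (chart_map (base_chart M p) p))"

definition tangent_map ::
    "('m, 'e::euclidean_space) manifold \<Rightarrow> ('n, 'f::euclidean_space) manifold
      \<Rightarrow> ('m \<Rightarrow> 'n) \<Rightarrow> 'm \<Rightarrow> 'e \<Rightarrow> 'f" where
  "tangent_map M N h p =
     frechet_derivative (chart_map (base_chart N (h p)) \<circ> h \<circ> chart_inv (base_chart M p))
       (at (chart_map (base_chart M p) p))"

definition differential ::
    "('m, 'e::euclidean_space) manifold \<Rightarrow> ('m \<Rightarrow> real) \<Rightarrow> 'm \<Rightarrow> 'e \<Rightarrow> real" where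
  "differential M h p =
     frechet_derivative (h \<circ> chart_inv (base_chart M p)) (at (chart_map (base_chart M p) p))"

definition smooth_function_on ::
    "('m, 'e::euclidean_space) manifold \<Rightarrow> 'm set \<Rightarrow> ('m \<Rightarrow> real) \<Rightarrow> bool" where
  "smooth_function_on M U h \<longleftrightarrow>
     (\<forall>c\<in>atlas M. smooth_on (chart_map c ` (U \<inter> chart_dom c)) (h \<circ> chart_inv c))"

definition vector_field_rep ::
    "('m, 'e::euclidean_space) manifold \<Rightarrow> ('m, 'e) chart \<Rightarrow> ('m \<Rightarrow> 'e) \<Rightarrow> 'e \<Rightarrow> 'e" where
  "vector_field_rep M c X y = tangent_coord M c (chart_inv c y) (X (chart_inv c y))"

text \<open>Smooth vector fields on an open set \<open>U\<close>; their values outside \<open>U\<close> are irrelevant.  All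
  conditions on tensor fields below are required for vector fields on arbitrary open subsets, in
  particular for globally defined ones.\<close>

definition vector_field_on ::
    "('m::topological_space, 'e::euclidean_space) manifold \<Rightarrow> 'm set \<Rightarrow> ('m \<Rightarrow> 'e) \<Rightarrow> bool" where
  "vector_field_on M U X \<longleftrightarrow> open U \<and>
     (\<forall>c\<in>atlas M. smooth_on (chart_map c ` (U \<inter> chart_dom c)) (vector_field_rep M c X))"

definition smooth_one_form ::
    "('m::topological_space, 'e::euclidean_space) manifold \<Rightarrow> ('m \<Rightarrow> 'e \<Rightarrow> real) \<Rightarrow> bool" where
  "smooth_one_form M \<eta> \<longleftrightarrow> (\<forall>p. linear (\<eta> p)) \<and>
     (\<forall>U X. vector_field_on M U X \<longrightarrow> smooth_function_on M U (\<lambda>p. \<eta> p (X p)))"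

definition smooth_endomorphism ::
    "('m::topological_space, 'e::euclidean_space) manifold \<Rightarrow> ('m \<Rightarrow> 'e \<Rightarrow> 'e) \<Rightarrow> bool" where
  "smooth_endomorphism M \<phi> \<longleftrightarrow> (\<forall>p. linear (\<phi> p)) \<and>
     (\<forall>U X. vector_field_on M U X \<longrightarrow> vector_field_on M U (\<lambda>p. \<phi> p (X p)))"

definition riemannian_metric ::
    "('m::topological_space, 'e::euclidean_space) manifold \<Rightarrow> ('m \<Rightarrow> 'e \<Rightarrow> 'e \<Rightarrow> real) \<Rightarrow> bool" where
  "riemannian_metric M g \<longleftrightarrow>
     (\<forall>p. bilinear (g p) \<and> (\<forall>u v. g p u v = g p v u) \<and> (\<forall>u. u \<noteq> 0 \<longrightarrow> 0 < g p u u)) \<and>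
     (\<forall>U X Y. vector_field_on M U X \<and> vector_field_on M U Y \<longrightarrow>
        smooth_function_on M U (\<lambda>p. g p (X p) (Y p)))"

text \<open>The derivative \<open>X h\<close> of a function along a vector field.\<close>

definition vf_apply ::
    "('m, 'e::euclidean_space) manifold \<Rightarrow> ('m \<Rightarrow> 'e) \<Rightarrow> ('m \<Rightarrow> real) \<Rightarrow> 'm \<Rightarrow> real" where
  "vf_apply M X h p = differential M h p (X p)"

text \<open>The Lie bracket at \<open>p\<close>, by the coordinate formula \<open>DY(X) - DX(Y)\<close> in the chart
  \<open>base_chart M p\<close>, in which the representatives of \<open>X\<close> and \<open>Y\<close> take the values \<open>X p\<close> and \<open>Y p\<close>
  at the point corresponding to \<open>p\<close>.\<close>

definition lie_bracket ::
    "('m, 'e::euclidean_space) manifold \<Rightarrow> ('m \<Rightarrow> 'e) \<Rightarrow> ('m \<Rightarrow> 'e) \<Rightarrow> 'm \<Rightarrow> 'e" where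
  "lie_bracket M X Y p =
     (let c = base_chart M p; y = chart_map c p in
        frechet_derivative (vector_field_rep M c Y) (at y) (X p) -
        frechet_derivative (vector_field_rep M c X) (at y) (Y p))"

definition nijenhuis ::
    "('m, 'e::euclidean_space) manifold \<Rightarrow> ('m \<Rightarrow> 'e \<Rightarrow> 'e) \<Rightarrow> ('m \<Rightarrow> 'e) \<Rightarrow> ('m \<Rightarrow> 'e) \<Rightarrow> 'm \<Rightarrow> 'e" where
  "nijenhuis M \<phi> X Y p =
     \<phi> p (\<phi> p (lie_bracket M X Y p)) + lie_bracket M (\<lambda>q. \<phi> q (X q)) (\<lambda>q. \<phi> q (Y q)) p
     - \<phi> p (lie_bracket M (\<lambda>q. \<phi> q (X q)) Y p) - \<phi> p (lie_bracket M X (\<lambda>q. \<phi> q (Y q)) p)"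


section \<open>Differential forms\<close>

text \<open>A form of degree \<open>k\<close> on a vector space is a function of a sequence of vectors that depends
  on the first \<open>k\<close> entries only.  The normalisations are those of Kobayashi and Nomizu:
  \<open>\<alpha> \<and> \<beta> = Alt (\<alpha> \<otimes> \<beta>)\<close> with \<open>Alt\<close> the projection onto alternating forms, and correspondingly the
  factors \<open>1/2\<close> and \<open>1/3\<close> in the exterior derivatives of 1-forms and 2-forms.\<close>

definition wedge ::
    "nat \<Rightarrow> nat \<Rightarrow> ((nat \<Rightarrow> 'v) \<Rightarrow> real) \<Rightarrow> ((nat \<Rightarrow> 'v) \<Rightarrow> real) \<Rightarrow> (nat \<Rightarrow> 'v) \<Rightarrow> real" where
  "wedge p q \<alpha> \<beta> v =
     (\<Sum>\<sigma> | \<sigma> permutes {..<p + q}.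
        of_int (sign \<sigma>) * \<alpha> (\<lambda>i. v (\<sigma> i)) * \<beta> (\<lambda>i. v (\<sigma> (p + i)))) / fact (p + q)"

definition form1 :: "('v \<Rightarrow> real) \<Rightarrow> (nat \<Rightarrow> 'v) \<Rightarrow> real" where
  "form1 a v = a (v 0)"

definition form2 :: "('v \<Rightarrow> 'v \<Rightarrow> real) \<Rightarrow> (nat \<Rightarrow> 'v) \<Rightarrow> real" where
  "form2 b v = b (v 0) (v 1)"

text \<open>The forms \<open>\<omega> \<and> \<dots> \<and> \<omega>\<close> (\<open>n\<close> factors, \<open>\<omega>\<close> of degree 2), and \<open>a\<^sub>1 \<and> (a\<^sub>2 \<and> \<dots> \<and> (a\<^sub>s \<and> \<omega>))\<close>
  for 1-forms \<open>a\<^sub>i\<close> and \<open>\<omega>\<close> of degree \<open>d\<close>.\<close>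

primrec wedge_power2 :: "('v \<Rightarrow> 'v \<Rightarrow> real) \<Rightarrow> nat \<Rightarrow> (nat \<Rightarrow> 'v) \<Rightarrow> real" where
  "wedge_power2 b 0 = (\<lambda>_. 1)"
| "wedge_power2 b (Suc n) = wedge 2 (2 * n) (form2 b) (wedge_power2 b n)"

primrec wedge_list :: "('v \<Rightarrow> real) list \<Rightarrow> nat \<Rightarrow> ((nat \<Rightarrow> 'v) \<Rightarrow> real) \<Rightarrow> (nat \<Rightarrow> 'v) \<Rightarrow> real" where
  "wedge_list [] d \<omega> = \<omega>"
| "wedge_list (a # as) d \<omega> = wedge 1 (length as + d) (form1 a) (wedge_list as d \<omega>)"

definition ext_deriv1 ::
    "('m, 'e::euclidean_space) manifold \<Rightarrow> ('m \<Rightarrow> 'e \<Rightarrow> real)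
      \<Rightarrow> ('m \<Rightarrow> 'e) \<Rightarrow> ('m \<Rightarrow> 'e) \<Rightarrow> 'm \<Rightarrow> real" where
  "ext_deriv1 M \<eta> X Y p =
     (vf_apply M X (\<lambda>q. \<eta> q (Y q)) p - vf_apply M Y (\<lambda>q. \<eta> q (X q)) p
      - \<eta> p (lie_bracket M X Y p)) / 2"

definition ext_deriv2 ::
    "('m, 'e::euclidean_space) manifold \<Rightarrow> ('m \<Rightarrow> 'e \<Rightarrow> 'e \<Rightarrow> real)
      \<Rightarrow> ('m \<Rightarrow> 'e) \<Rightarrow> ('m \<Rightarrow> 'e) \<Rightarrow> ('m \<Rightarrow> 'e) \<Rightarrow> 'm \<Rightarrow> real" where
  "ext_deriv2 M \<omega> X Y Z p =
     (vf_apply M X (\<lambda>q. \<omega> q (Y q) (Z q)) p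
      + vf_apply M Y (\<lambda>q. \<omega> q (Z q) (X q)) p
      + vf_apply M Z (\<lambda>q. \<omega> q (X q) (Y q)) p
      - \<omega> p (lie_bracket M X Y p) (Z p)
      - \<omega> p (lie_bracket M Y Z p) (X p)
      - \<omega> p (lie_bracket M Z X p) (Y p)) / 3"

definition fundamental_form ::
    "('m \<Rightarrow> 'e \<Rightarrow> 'e \<Rightarrow> real) \<Rightarrow> ('m \<Rightarrow> 'e \<Rightarrow> 'e) \<Rightarrow> 'm \<Rightarrow> 'e \<Rightarrow> 'e \<Rightarrow> real" where
  "fundamental_form g \<phi> p u v = g p u (\<phi> p v)"


section \<open>Kaehler manifolds and warped products\<close>

text \<open>Integrability of the almost complex structure is expressed by the vanishing of its torsion.\<close>

definition kaehler_manifold ::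
    "('m::{t2_space,second_countable_topology}, 'e::euclidean_space) manifold
      \<Rightarrow> ('m \<Rightarrow> 'e \<Rightarrow> 'e) \<Rightarrow> ('m \<Rightarrow> 'e \<Rightarrow> 'e \<Rightarrow> real) \<Rightarrow> bool" where
  "kaehler_manifold F J G \<longleftrightarrow>
     smooth_manifold F \<and> smooth_endomorphism F J \<and> riemannian_metric F G \<and>
     (\<forall>p u. J p (J p u) = - u) \<and>
     (\<forall>p u v. G p (J p u) (J p v) = G p u v) \<and>
     (\<forall>U X Y. vector_field_on F U X \<and> vector_field_on F U Y \<longrightarrow>
        (\<forall>p\<in>U. nijenhuis F J X Y p = 0)) \<and>
     (\<forall>U X Y Z. vector_field_on F U X \<and> vector_field_on F U Y \<and> vector_field_on F U Z \<longrightarrow>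
        (\<forall>p\<in>U. ext_deriv2 F (fundamental_form G J) X Y Z p = 0))"

definition warped_metric ::
    "('m, 'e::euclidean_space) manifold \<Rightarrow> (real ^ 's \<Rightarrow> real) \<Rightarrow> ('m \<Rightarrow> 'e \<Rightarrow> 'e \<Rightarrow> real)
      \<Rightarrow> (real ^ 's) \<times> 'm \<Rightarrow> (real ^ 's) \<times> 'e \<Rightarrow> (real ^ 's) \<times> 'e \<Rightarrow> real" where
  "warped_metric F f G p u v =
     (let M = prod_manifold euclidean_manifold F;
          dt = (\<lambda>i. differential M (\<lambda>q. fst q $ i) p);
          d\<pi> = tangent_map M F snd p
      in (\<Sum>i\<in>UNIV. dt i u * dt i v) + (f (fst p))\<^sup>2 * G (snd p) (d\<pi> u) (d\<pi> v))"


section \<open>Generalized Kenmotsu manifolds\<close>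

definition metric_f_manifold ::
    "nat \<Rightarrow> ('m::{t2_space,second_countable_topology}, 'e::euclidean_space) manifold
      \<Rightarrow> ('m \<Rightarrow> 'e \<Rightarrow> 'e) \<Rightarrow> ('s::finite \<Rightarrow> 'm \<Rightarrow> 'e) \<Rightarrow> ('s \<Rightarrow> 'm \<Rightarrow> 'e \<Rightarrow> real)
      \<Rightarrow> ('m \<Rightarrow> 'e \<Rightarrow> 'e \<Rightarrow> real) \<Rightarrow> bool" where
  "metric_f_manifold n M \<phi> \<xi> \<eta> g \<longleftrightarrow>
     1 \<le> n \<and> DIM('e) = 2 * n + CARD('s) \<and>
     smooth_manifold M \<and> smooth_endomorphism M \<phi> \<and>
     (\<forall>i. vector_field_on M UNIV (\<xi> i)) \<and> (\<forall>i. smooth_one_form M (\<eta> i)) \<and>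
     riemannian_metric M g \<and>
     (\<forall>p u. \<phi> p (\<phi> p u) = - u + (\<Sum>i\<in>UNIV. \<eta> i p u *\<^sub>R \<xi> i p)) \<and>
     (\<forall>p i j. \<eta> i p (\<xi> j p) = (if i = j then 1 else 0)) \<and>
     (\<forall>p u v. g p (\<phi> p u) (\<phi> p v) = g p u v - (\<Sum>i\<in>UNIV. \<eta> i p u * \<eta> i p v))"

text \<open>The index type \<open>'s\<close> is not ordered, so the non-vanishing of \<open>\<eta>\<^sup>1 \<and> \<dots> \<and> \<eta>\<^sup>s \<and> \<Phi>\<^sup>n\<close> is required
  for every enumeration of the indices; the enumeration affects only the sign of this form.\<close>

definition almost_s_contact_metric_manifold ::
    "nat \<Rightarrow> ('m::{t2_space,second_countable_topology}, 'e::euclidean_space) manifold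
      \<Rightarrow> ('m \<Rightarrow> 'e \<Rightarrow> 'e) \<Rightarrow> ('s::finite \<Rightarrow> 'm \<Rightarrow> 'e) \<Rightarrow> ('s \<Rightarrow> 'm \<Rightarrow> 'e \<Rightarrow> real)
      \<Rightarrow> ('m \<Rightarrow> 'e \<Rightarrow> 'e \<Rightarrow> real) \<Rightarrow> bool" where
  "almost_s_contact_metric_manifold n M \<phi> \<xi> \<eta> g \<longleftrightarrow>
     metric_f_manifold n M \<phi> \<xi> \<eta> g \<and>
     (\<forall>is. distinct is \<and> set is = UNIV \<longrightarrow>
        (\<forall>p. \<exists>v. wedge_list (map (\<lambda>i. \<eta> i p) is) (2 * n)
                   (wedge_power2 (fundamental_form g \<phi> p) n) v \<noteq> 0))"

definition generalized_almost_kenmotsu_manifold ::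
    "nat \<Rightarrow> ('m::{t2_space,second_countable_topology}, 'e::euclidean_space) manifold
      \<Rightarrow> ('m \<Rightarrow> 'e \<Rightarrow> 'e) \<Rightarrow> ('s::finite \<Rightarrow> 'm \<Rightarrow> 'e) \<Rightarrow> ('s \<Rightarrow> 'm \<Rightarrow> 'e \<Rightarrow> real)
      \<Rightarrow> ('m \<Rightarrow> 'e \<Rightarrow> 'e \<Rightarrow> real) \<Rightarrow> bool" where
  "generalized_almost_kenmotsu_manifold n M \<phi> \<xi> \<eta> g \<longleftrightarrow>
     almost_s_contact_metric_manifold n M \<phi> \<xi> \<eta> g \<and>
     (\<forall>i U X Y. vector_field_on M U X \<and> vector_field_on M U Y \<longrightarrow>
        (\<forall>p\<in>U. ext_deriv1 M (\<eta> i) X Y p = 0)) \<and>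
     (\<forall>U X Y Z. vector_field_on M U X \<and> vector_field_on M U Y \<and> vector_field_on M U Z \<longrightarrow>
        (\<forall>p\<in>U. ext_deriv2 M (fundamental_form g \<phi>) X Y Z p =
           2 * (\<Sum>i\<in>UNIV. wedge 1 2 (form1 (\<eta> i p)) (form2 (fundamental_form g \<phi> p))
                              ((!) [X p, Y p, Z p]))))"

definition normal_structure ::
    "('m::topological_space, 'e::euclidean_space) manifold
      \<Rightarrow> ('m \<Rightarrow> 'e \<Rightarrow> 'e) \<Rightarrow> ('s::finite \<Rightarrow> 'm \<Rightarrow> 'e) \<Rightarrow> ('s \<Rightarrow> 'm \<Rightarrow> 'e \<Rightarrow> real) \<Rightarrow> bool" where
  "normal_structure M \<phi> \<xi> \<eta> \<longleftrightarrow>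
     (\<forall>U X Y. vector_field_on M U X \<and> vector_field_on M U Y \<longrightarrow>
        (\<forall>p\<in>U. nijenhuis M \<phi> X Y p +
           2 *\<^sub>R (\<Sum>i\<in>UNIV. ext_deriv1 M (\<eta> i) X Y p *\<^sub>R \<xi> i p) = 0))"

definition generalized_kenmotsu_manifold ::
    "nat \<Rightarrow> ('m::{t2_space,second_countable_topology}, 'e::euclidean_space) manifold
      \<Rightarrow> ('m \<Rightarrow> 'e \<Rightarrow> 'e) \<Rightarrow> ('s::finite \<Rightarrow> 'm \<Rightarrow> 'e) \<Rightarrow> ('s \<Rightarrow> 'm \<Rightarrow> 'e \<Rightarrow> real)
      \<Rightarrow> ('m \<Rightarrow> 'e \<Rightarrow> 'e \<Rightarrow> real) \<Rightarrow> bool" where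
  "generalized_kenmotsu_manifold n M \<phi> \<xi> \<eta> g \<longleftrightarrow>
     generalized_almost_kenmotsu_manifold n M \<phi> \<xi> \<eta> g \<and> normal_structure M \<phi> \<xi> \<eta>"

end

theory Submission
  imports Defs
begin

text \<open>
  On \<open>\<real>\<^sup>s \<times> F\<close> take \<open>\<phi> = 0 \<oplus> J\<close>, \<open>\<xi>\<^sub>i = \<partial>/\<partial>t\<^sub>i\<close> and \<open>\<eta>\<^sup>i = dt\<^sub>i\<close>.  The fundamental form is
  \<open>\<Phi> = f\<^sup>2 \<Omega>\<close> with \<open>\<Omega>\<close> the Kaehler form of \<open>F\<close>, so \<open>d\<Omega> = 0\<close> and \<open>df = f \<Sum> dt\<^sub>i\<close> give
  \<open>d\<Phi> = 2 \<Sum> \<eta>\<^sup>i \<and> \<Phi>\<close>, while the torsion of \<open>\<phi>\<close> is \<open>0 \<oplus> [J, J] = 0\<close>.  The hypotheses on \<open>F\<close> concern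
  vector fields on \<open>F\<close>, whereas a vector field on the product also depends on \<open>t\<close>.  The torsion and
  the exterior derivative are therefore first written in a chart, where the derivatives of the vector
  fields cancel and only the derivatives of the components of \<open>J\<close> and \<open>\<Omega>\<close> remain.  For the
  non-vanishing of \<open>\<eta>\<^sup>1 \<and> \<dots> \<and> \<eta>\<^sup>s \<and> \<Phi>\<^sup>n\<close> the form is evaluated on \<open>\<xi>\<^sub>1, \<dots>, \<xi>\<^sub>s\<close> followed by a
  symplectic basis, on which all nonzero terms of the alternating sum have the same sign.
\<close>

section \<open>Smooth maps between Euclidean spaces\<close>

lemma has_derivative_frechet: "f differentiable at x \<Longrightarrow> (f has_derivative frechet_derivative f (at x)) (at x)"
  by (simp add: frechet_derivative_works)

lemma frechet_derivative_eqI: "(f has_derivative f') (at x) \<Longrightarrow> frechet_derivative f (at x) = f'"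
  by (rule frechet_derivative_at [symmetric])

text \<open>\<open>frechet_derivative\<close> is a choice among all derivatives at the point.
  Functions that agree near \<open>x\<close> have the same derivatives there, so the same choice is
  made, even if no derivative exists.\<close>

lemma frechet_derivative_cong_open:
  assumes "open S" "x \<in> S" "\<And>y. y \<in> S \<Longrightarrow> f y = g y"
  shows "frechet_derivative f (at x) = frechet_derivative g (at x)"
proof -
  have "(f has_derivative D) (at x) \<longleftrightarrow> (g has_derivative D) (at x)" for D
    using has_derivative_transform_within_open[OF _ assms(1,2), of f D UNIV g]
      has_derivative_transform_within_open[OF _ assms(1,2), of g D UNIV f] assms(3) by auto
  then show ?thesis by (simp add: frechet_derivative_def)
qed

lemma differentiable_cong_open:
  assumes "open S" "x \<in> S" "\<And>y. y \<in> S \<Longrightarrow> f y = g y" "f differentiable at x"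
  shows "g differentiable at x"
  using assms(4) has_derivative_transform_within_open[OF _ assms(1,2), of f _ UNIV g] assms(3)
  unfolding differentiable_def by auto

lemma Ck_on_cong:
  assumes "open S" "\<And>x. x \<in> S \<Longrightarrow> f x = g x" "Ck_on k S f"
  shows "Ck_on k S g"
  using assms(2,3)
proof (induction k arbitrary: f g)
  case 0
  then show ?case using continuous_on_cong[OF refl, of S f g] by simp
next
  case (Suc k)
  have "g differentiable at x" if "x \<in> S" for x
    using differentiable_cong_open[OF assms(1) that, of f g] Suc.prems that by simp
  moreover have "Ck_on k S (\<lambda>x. frechet_derivative g (at x) v)" for v
    by (rule Suc.IH[of "\<lambda>x. frechet_derivative f (at x) v"])
      (use frechet_derivative_cong_open[OF assms(1), of _ f g] Suc.prems in auto)
  ultimately show ?case by simp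
qed

lemma Ck_on_SucD: "Ck_on (Suc k) S f \<Longrightarrow> Ck_on k S f"
proof (induction k arbitrary: f)
  case 0
  then show ?case
    by (auto intro!: continuous_at_imp_continuous_on differentiable_imp_continuous_within)
qed auto

text \<open>Lets the closure proofs below work with a derivative given by a formula. It agrees with
  \<open>frechet_derivative\<close> on the open set \<open>S\<close>, and \<open>Ck_on_cong\<close>
  transfers the class.\<close>

lemma Ck_on_SucI:
  assumes "open S" and "\<And>x. x \<in> S \<Longrightarrow> (f has_derivative f' x) (at x)"
    and "\<And>v. Ck_on k S (\<lambda>x. f' x v)"
  shows "Ck_on (Suc k) S f"
proof -
  have "Ck_on k S (\<lambda>x. frechet_derivative f (at x) v)" for v
    by (rule Ck_on_cong[OF assms(1) _ assms(3)[of v]]) (simp add: frechet_derivative_eqI[OF assms(2)])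
  with assms(2) show ?thesis by (auto simp: differentiable_def)
qed

lemma Ck_on_has_derivative:
  "Ck_on (Suc k) S f \<Longrightarrow> x \<in> S \<Longrightarrow> (f has_derivative frechet_derivative f (at x)) (at x)"
  by (simp add: has_derivative_frechet)

lemma Ck_on_const: "open S \<Longrightarrow> Ck_on k S (\<lambda>_. c)"
proof (induction k arbitrary: c)
  case (Suc k)
  then show ?case by (intro Ck_on_SucI[where f' = "\<lambda>_ _. 0"]) auto
qed simp

lemma Ck_on_linear:
  assumes "open S" "bounded_linear L" "Ck_on k S f"
  shows "Ck_on k S (\<lambda>x. L (f x))"
  using assms(3)
proof (induction k arbitrary: f)
  case 0
  then show ?case using bounded_linear.continuous_on[OF assms(2)] by simp
next
  case (Suc k)
  show ?case
    by (rule Ck_on_SucI[where f' = "\<lambda>x v. L (frechet_derivative f (at x) v)"])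
      (use Suc assms(1) in \<open>auto intro!: bounded_linear.has_derivative[OF assms(2)] has_derivative_frechet\<close>)
qed

lemma Ck_on_add:
  assumes "open S" "Ck_on k S f" "Ck_on k S g"
  shows "Ck_on k S (\<lambda>x. f x + g x)"
  using assms(2,3)
proof (induction k arbitrary: f g)
  case 0
  then show ?case by (simp add: continuous_on_add)
next
  case (Suc k)
  show ?case
    by (rule Ck_on_SucI[where f' = "\<lambda>x v. frechet_derivative f (at x) v + frechet_derivative g (at x) v"])
      (use Suc assms(1) in \<open>auto intro!: has_derivative_add has_derivative_frechet\<close>)
qed

lemma Ck_on_sum:
  assumes "open S" "\<And>i. i \<in> I \<Longrightarrow> Ck_on k S (f i)"
  shows "Ck_on k S (\<lambda>x. \<Sum>i\<in>I. f i x)"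
  using assms(2)
  by (induction I rule: infinite_finite_induct) (auto intro: Ck_on_add Ck_on_const assms(1))

text \<open>By the product rule a directional derivative is a sum of two terms that have again the
  form \<open>B (f x) (g x)\<close>, with one factor differentiated. Hence the induction runs over
  arbitrary \<open>f\<close> and \<open>g\<close>, and \<open>Ck_on_SucD\<close> lowers the class of
  the other factor.\<close>

lemma Ck_on_bilinear:
  assumes "open S" "bounded_bilinear B" "Ck_on k S f" "Ck_on k S g"
  shows "Ck_on k S (\<lambda>x. B (f x) (g x))"
  using assms(3,4)
proof (induction k arbitrary: f g)
  case 0
  then show ?case using bounded_bilinear.continuous_on[OF assms(2)] by simp
next
  case (Suc k)
  have fg: "Ck_on k S f" "Ck_on k S g" using Suc.prems Ck_on_SucD by auto
  show ?case
  proof (rule Ck_on_SucI[where f' = "\<lambda>x v. B (f x) (frechet_derivative g (at x) v) + B (frechet_derivative f (at x) v) (g x)"])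
    show "((\<lambda>x. B (f x) (g x)) has_derivative (\<lambda>v. B (f x) (frechet_derivative g (at x) v)
        + B (frechet_derivative f (at x) v) (g x))) (at x)" if "x \<in> S" for x
      by (rule bounded_bilinear.FDERIV[OF assms(2)]; rule Ck_on_has_derivative[where k = k, OF _ that];
          rule Suc.prems)
    show "Ck_on k S (\<lambda>x. B (f x) (frechet_derivative g (at x) v) + B (frechet_derivative f (at x) v) (g x))" for v
      using Suc.prems fg by (intro Ck_on_add Suc.IH assms(1)) auto
  qed fact
qed

lemma linear_euclidean_sum:
  fixes L :: "'a::euclidean_space \<Rightarrow> 'b::real_vector"
  assumes "linear L"
  shows "L v = (\<Sum>b\<in>Basis. (v \<bullet> b) *\<^sub>R L b)"
proof -
  have "L v = L (\<Sum>b\<in>Basis. (v \<bullet> b) *\<^sub>R b)" by (simp add: euclidean_representation)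
  also have "\<dots> = (\<Sum>b\<in>Basis. (v \<bullet> b) *\<^sub>R L b)"
    by (simp add: linear_sum[OF assms] linear_scale[OF assms])
  finally show ?thesis .
qed

text \<open>In the chain rule the direction in which \<open>g\<close> is differentiated moves with
  \<open>x\<close>. Expanding it in \<open>Basis\<close> gives a finite sum of products of
  components of the derivative of \<open>f\<close> with derivatives of \<open>g\<close> in fixed
  directions, composed with \<open>f\<close>; the induction hypothesis covers the latter.\<close>

lemma Ck_on_compose:
  fixes g :: "'b::euclidean_space \<Rightarrow> 'c::real_normed_vector"
  assumes "open S" "open T" "f ` S \<subseteq> T" "Ck_on k S f" "Ck_on k T g"
  shows "Ck_on k S (g \<circ> f)"
  using assms(4,5)
proof (induction k arbitrary: g)
  case 0
  then show ?case using assms(3) continuous_on_compose[of S f g] continuous_on_subset[of T g "f ` S"] by simp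
next
  case (Suc k)
  let ?f' = "\<lambda>x. frechet_derivative f (at x)" and ?g' = "\<lambda>x. frechet_derivative g (at x)"
  show ?case
  proof (rule Ck_on_SucI[where f' = "\<lambda>x v. ?g' (f x) (?f' x v)"])
    show "(g \<circ> f has_derivative (\<lambda>v. ?g' (f x) (?f' x v))) (at x)" if "x \<in> S" for x
    proof -
      have "(f has_derivative ?f' x) (at x)" "(g has_derivative ?g' (f x)) (at (f x))"
        using Ck_on_has_derivative[OF Suc.prems(1) that] Ck_on_has_derivative[OF Suc.prems(2), of "f x"]
          that assms(3) by auto
      from diff_chain_at[OF this] show ?thesis by (simp add: o_def)
    qed
    fix v
    have "Ck_on k S (\<lambda>x. \<Sum>b\<in>Basis. (?f' x v \<bullet> b) *\<^sub>R ((\<lambda>y. ?g' y b) \<circ> f) x)"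
      using Suc.prems Ck_on_SucD[OF Suc.prems(1)]
      by (intro Ck_on_sum assms(1) Ck_on_bilinear[OF _ bounded_bilinear_scaleR] Suc.IH
          Ck_on_linear[OF _ bounded_linear_inner_left]) auto
    then show "Ck_on k S (\<lambda>x. ?g' (f x) (?f' x v))"
      by (rule Ck_on_cong[OF assms(1), rotated])
        (use linear_euclidean_sum[OF linear_frechet_derivative, of g _ "?f' _ v"] Suc.prems assms(3)
          in \<open>auto simp: subset_iff\<close>)
  qed fact
qed

lemma smooth_on_cong: "smooth_on S f \<Longrightarrow> open S \<Longrightarrow> (\<And>x. x \<in> S \<Longrightarrow> f x = g x) \<Longrightarrow> smooth_on S g"
  unfolding smooth_on_def using Ck_on_cong by blast

lemma smooth_on_differentiable: "smooth_on S f \<Longrightarrow> x \<in> S \<Longrightarrow> f differentiable at x"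
  unfolding smooth_on_def using Ck_on.simps(2) by blast

lemma smooth_on_frechet: "smooth_on S f \<Longrightarrow> smooth_on S (\<lambda>x. frechet_derivative f (at x) v)"
  unfolding smooth_on_def using Ck_on.simps(2) by blast

lemma smooth_on_const: "open S \<Longrightarrow> smooth_on S (\<lambda>_. c)"
  by (simp add: smooth_on_def Ck_on_const)

lemma smooth_on_linear: "open S \<Longrightarrow> bounded_linear L \<Longrightarrow> smooth_on S f \<Longrightarrow> smooth_on S (\<lambda>x. L (f x))"
  by (simp add: smooth_on_def Ck_on_linear)

lemma smooth_on_id:
  assumes "open S"
  shows "smooth_on S (\<lambda>x. x)"
proof -
  have "Ck_on k S (\<lambda>x. x)" for k
    by (cases k) (auto intro!: Ck_on_SucI[where f' = "\<lambda>_ v. v"] Ck_on_const assms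
        simp del: Ck_on.simps(2) simp: continuous_on_id)
  then show ?thesis by (simp add: smooth_on_def)
qed

lemma smooth_on_add: "open S \<Longrightarrow> smooth_on S f \<Longrightarrow> smooth_on S g \<Longrightarrow> smooth_on S (\<lambda>x. f x + g x)"
  by (simp add: smooth_on_def Ck_on_add)

lemma smooth_on_sum:
  "open S \<Longrightarrow> (\<And>i. i \<in> I \<Longrightarrow> smooth_on S (f i)) \<Longrightarrow> smooth_on S (\<lambda>x. \<Sum>i\<in>I. f i x)"
  by (simp add: smooth_on_def Ck_on_sum)

lemma smooth_on_bilinear:
  "open S \<Longrightarrow> bounded_bilinear B \<Longrightarrow> smooth_on S f \<Longrightarrow> smooth_on S g \<Longrightarrow> smooth_on S (\<lambda>x. B (f x) (g x))"
  by (simp add: smooth_on_def Ck_on_bilinear)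

lemmas smooth_on_scaleR = smooth_on_bilinear[OF _ bounded_bilinear_scaleR]
lemmas smooth_on_mult = smooth_on_bilinear[OF _ bounded_bilinear_mult]

lemma smooth_on_compose:
  fixes g :: "'b::euclidean_space \<Rightarrow> 'c::real_normed_vector"
  shows "open S \<Longrightarrow> open T \<Longrightarrow> f ` S \<subseteq> T \<Longrightarrow> smooth_on S f \<Longrightarrow> smooth_on T g \<Longrightarrow> smooth_on S (g \<circ> f)"
  by (simp add: smooth_on_def Ck_on_compose)

text \<open>The derivative in direction \<open>v\<close> is a function of the same shape with
  \<open>c\<close> replaced by \<open>c * L v\<close>, so the induction is over arbitrary
  \<open>c\<close>.\<close>

lemma smooth_on_exp_linear:
  fixes L :: "'a::euclidean_space \<Rightarrow> real"
  assumes "bounded_linear L"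
  shows "smooth_on UNIV (\<lambda>x. c * exp (L x))"
proof -
  have "Ck_on k UNIV (\<lambda>x. c * exp (L x))" for k
  proof (induction k arbitrary: c)
    case 0
    then show ?case
      by (auto intro!: continuous_intros bounded_linear.continuous_on[OF assms])
  next
    case (Suc k)
    show ?case
      by (rule Ck_on_SucI[where f' = "\<lambda>x v. (c * L v) * exp (L x)"])
        (use Suc in \<open>auto intro!: derivative_eq_intros bounded_linear.has_derivative[OF assms]\<close>)
  qed
  then show ?thesis by (simp add: smooth_on_def)
qed

lemma smooth_on_Pair:
  assumes "open S" "smooth_on S f" "smooth_on S g"
  shows "smooth_on S (\<lambda>x. (f x, g x))"
proof -
  have "smooth_on S (\<lambda>x. (f x, 0) + (0, g x))"
    by (intro smooth_on_add assms smooth_on_linear[where L = "\<lambda>u. (u, 0)"]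
        smooth_on_linear[where L = "\<lambda>u. (0, u)"] bounded_linear_Pair
        bounded_linear_ident bounded_linear_zero)
  then show ?thesis by simp
qed

section \<open>Families of linear and bilinear maps depending on a point\<close>

text \<open>A product rule for which \<open>A\<close> need only be differentiable at each fixed
  vector. Expanding \<open>x z\<close> in \<open>Basis\<close> reduces it to finitely many such
  vectors. It is the source of the coordinate formulas for torsion and exterior derivative.\<close>

lemma has_derivative_linear_family:
  fixes A :: "'a::real_normed_vector \<Rightarrow> 'b::euclidean_space \<Rightarrow> 'c::real_normed_vector"
  assumes S: "open S" "y \<in> S" and lin: "\<And>z. z \<in> S \<Longrightarrow> linear (A z)"
    and A': "\<And>v. ((\<lambda>z. A z v) has_derivative A' v) (at y)" and x: "(x has_derivative x') (at y)"
  shows "((\<lambda>z. A z (x z)) has_derivative (\<lambda>w. A' (x y) w + A y (x' w))) (at y)"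
proof -
  have "((\<lambda>z. \<Sum>b\<in>Basis. (x z \<bullet> b) *\<^sub>R A z b) has_derivative
      (\<lambda>w. \<Sum>b\<in>Basis. (x y \<bullet> b) *\<^sub>R A' b w + (x' w \<bullet> b) *\<^sub>R A y b)) (at y)"
    by (intro has_derivative_sum has_derivative_scaleR has_derivative_inner_left x A')
  then have 1: "((\<lambda>z. A z (x z)) has_derivative
      (\<lambda>w. \<Sum>b\<in>Basis. (x y \<bullet> b) *\<^sub>R A' b w + (x' w \<bullet> b) *\<^sub>R A y b)) (at y)"
    by (rule has_derivative_transform_within_open[OF _ S]) (simp add: linear_euclidean_sum[OF lin, symmetric])
  \<comment> \<open>The same expansion with the vector frozen at \<open>x y\<close>: uniqueness of
    derivatives then shows that the sum over \<open>Basis\<close> is \<open>A' (x y)\<close>, so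
    \<open>A'\<close> need not be assumed linear in its vector argument.\<close>
  have "((\<lambda>z. \<Sum>b\<in>Basis. (x y \<bullet> b) *\<^sub>R A z b) has_derivative (\<lambda>w. \<Sum>b\<in>Basis. (x y \<bullet> b) *\<^sub>R A' b w)) (at y)"
    by (intro has_derivative_sum has_derivative_scaleR_right A')
  then have "((\<lambda>z. A z (x y)) has_derivative (\<lambda>w. \<Sum>b\<in>Basis. (x y \<bullet> b) *\<^sub>R A' b w)) (at y)"
    by (rule has_derivative_transform_within_open[OF _ S]) (simp add: linear_euclidean_sum[OF lin, symmetric])
  from has_derivative_unique[OF this A']
  have 2: "(\<Sum>b\<in>Basis. (x y \<bullet> b) *\<^sub>R A' b w) = A' (x y) w" for w by (rule fun_cong)
  have "(\<Sum>b\<in>Basis. (x y \<bullet> b) *\<^sub>R A' b w + (x' w \<bullet> b) *\<^sub>R A y b) = A' (x y) w + A y (x' w)" for w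
    by (simp add: sum.distrib 2 linear_euclidean_sum[OF lin[OF S(2)], symmetric])
  with 1 show ?thesis by simp
qed

text \<open>The linear case is used twice: for the first argument with the second inserted, and for
  the second argument with the first one fixed.\<close>

lemma has_derivative_bilinear_family:
  fixes B :: "'a::real_normed_vector \<Rightarrow> 'b::euclidean_space \<Rightarrow> 'b \<Rightarrow> 'c::real_normed_vector"
  assumes S: "open S" "y \<in> S" and bil: "\<And>z. z \<in> S \<Longrightarrow> bilinear (B z)"
    and B': "\<And>u v. ((\<lambda>z. B z u v) has_derivative B' u v) (at y)"
    and x: "(x has_derivative x') (at y)" and r: "(r has_derivative r') (at y)"
  shows "((\<lambda>z. B z (x z) (r z)) has_derivative
    (\<lambda>w. B' (x y) (r y) w + B y (x y) (r' w) + B y (x' w) (r y))) (at y)"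
proof (rule has_derivative_linear_family[OF S _ _ x, of "\<lambda>z u. B z u (r z)"])
  show "linear (\<lambda>u. B z u (r z))" if "z \<in> S" for z using bil[OF that] by (simp add: bilinear_def)
  show "((\<lambda>z. B z u (r z)) has_derivative (\<lambda>w. B' u (r y) w + B y u (r' w))) (at y)" for u
    by (rule has_derivative_linear_family[OF S _ B' r]) (use bil in \<open>simp add: bilinear_def\<close>)
qed

lemma smooth_on_linear_family:
  fixes A :: "'a::euclidean_space \<Rightarrow> 'b::euclidean_space \<Rightarrow> 'c::real_normed_vector"
  assumes S: "open S" and lin: "\<And>z. z \<in> S \<Longrightarrow> linear (A z)"
    and A: "\<And>v. smooth_on S (\<lambda>z. A z v)" and x: "smooth_on S x"
  shows "smooth_on S (\<lambda>z. A z (x z))"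
proof -
  have "smooth_on S (\<lambda>z. \<Sum>b\<in>Basis. (x z \<bullet> b) *\<^sub>R A z b)"
    by (intro smooth_on_sum S smooth_on_scaleR A smooth_on_linear[OF S bounded_linear_inner_left] x)
  then show ?thesis
    by (rule smooth_on_cong[OF _ S]) (simp add: linear_euclidean_sum[OF lin, symmetric])
qed

lemma smooth_on_bilinear_family:
  fixes B :: "'a::euclidean_space \<Rightarrow> 'b::euclidean_space \<Rightarrow> 'b \<Rightarrow> 'c::real_normed_vector"
  assumes S: "open S" and bil: "\<And>z. z \<in> S \<Longrightarrow> bilinear (B z)"
    and B: "\<And>u v. smooth_on S (\<lambda>z. B z u v)" and x: "smooth_on S x" and r: "smooth_on S r"
  shows "smooth_on S (\<lambda>z. B z (x z) (r z))"
proof (rule smooth_on_linear_family[OF S _ _ x, of "\<lambda>z u. B z u (r z)"])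
  show "linear (\<lambda>u. B z u (r z))" if "z \<in> S" for z using bil[OF that] by (simp add: bilinear_def)
  show "smooth_on S (\<lambda>z. B z u (r z))" for u
    by (rule smooth_on_linear_family[OF S _ B r]) (use bil in \<open>simp add: bilinear_def\<close>)
qed


section \<open>Alternating forms\<close>

text \<open>Only the sign rule for permutations of the first \<open>d\<close> entries is recorded;
  the evaluations of wedge products below rest on it.\<close>

definition alternating_form :: "nat \<Rightarrow> ((nat \<Rightarrow> 'v) \<Rightarrow> real) \<Rightarrow> bool" where
  "alternating_form d \<omega> \<longleftrightarrow> (\<forall>v \<tau>. \<tau> permutes {..<d} \<longrightarrow> \<omega> (\<lambda>i. v (\<tau> i)) = of_int (sign \<tau>) * \<omega> v)"

lemma alternating_formD:
  "alternating_form d \<omega> \<Longrightarrow> \<tau> permutes {..<d} \<Longrightarrow> \<omega> (\<lambda>i. v (\<tau> i)) = of_int (sign \<tau>) * \<omega> v"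
  by (auto simp: alternating_form_def)

lemma permutes_lessThan_permutation: "\<tau> permutes {..<d::nat} \<Longrightarrow> permutation \<tau>"
  using permutation_permutes by blast

text \<open>Substituting \<tau> \<circ> \<sigma> for \<sigma> permutes the terms of the defining sum
  and pulls out the sign of \<tau>. The factors \<alpha> and \<beta> may be arbitrary
  functions.\<close>

lemma alternating_form_wedge: "alternating_form (p + q) (wedge p q \<alpha> \<beta>)"
  for \<alpha> \<beta> :: "(nat \<Rightarrow> 'v) \<Rightarrow> real"
  unfolding alternating_form_def
proof (intro allI impI)
  fix v :: "nat \<Rightarrow> 'v" and \<tau> assume \<tau>: "\<tau> permutes {..<p + q}"
  let ?t = "\<lambda>\<sigma>. of_int (sign \<sigma>) * \<alpha> (\<lambda>i. v (\<sigma> i)) * \<beta> (\<lambda>i. v (\<sigma> (p + i)))"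
  have "(\<Sum>\<sigma> | \<sigma> permutes {..<p + q}. ?t \<sigma>) = (\<Sum>\<sigma> | \<sigma> permutes {..<p + q}. ?t (\<tau> \<circ> \<sigma>))"
    by (rule setum_permutations_compose_left[OF \<tau>])
  also have "\<dots> = of_int (sign \<tau>) * (\<Sum>\<sigma> | \<sigma> permutes {..<p + q}.
      of_int (sign \<sigma>) * \<alpha> (\<lambda>i. v (\<tau> (\<sigma> i))) * \<beta> (\<lambda>i. v (\<tau> (\<sigma> (p + i)))))"
    unfolding sum_distrib_left
    by (rule sum.cong)
      (simp_all add: sign_compose permutes_lessThan_permutation[OF \<tau>]
        permutes_lessThan_permutation[where d = "p + q"])
  finally have eq: "(\<Sum>\<sigma> | \<sigma> permutes {..<p + q}.
      of_int (sign \<sigma>) * \<alpha> (\<lambda>i. v (\<tau> (\<sigma> i))) * \<beta> (\<lambda>i. v (\<tau> (\<sigma> (p + i)))))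
    = of_int (sign \<tau>) * (\<Sum>\<sigma> | \<sigma> permutes {..<p + q}. ?t \<sigma>)"
    by (simp add: sign_def)
  show "wedge p q \<alpha> \<beta> (\<lambda>i. v (\<tau> i)) = of_int (sign \<tau>) * wedge p q \<alpha> \<beta> v"
    by (simp add: wedge_def eq)
qed

lemma alternating_form_wedge_power2: "alternating_form (2 * n) (wedge_power2 b n)"
proof (cases n)
  case 0
  then show ?thesis by (simp add: alternating_form_def)
next
  case (Suc m)
  then show ?thesis using alternating_form_wedge[of 2 "2 * m" "form2 b" "wedge_power2 b m"] by simp
qed

lemma alternating_form_wedge_list:
  "alternating_form d \<omega> \<Longrightarrow> alternating_form (length as + d) (wedge_list as d \<omega>)"
proof (cases as)
  case (Cons a as')
  then show ?thesis using alternating_form_wedge[of 1 "length as' + d" "form1 a" "wedge_list as' d \<omega>"] by simp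
qed simp

section \<open>Wedge products of 1-forms on adapted arguments\<close>

text \<open>Such a permutation moves only the last \<open>q\<close> entries; transporting it along
  the shift by \<open>p\<close> keeps its sign. This makes the sign rule of the second factor of a
  wedge product applicable.\<close>

lemma permutes_fix_initial:
  assumes \<sigma>: "\<sigma> permutes {..<p + q}" and fx: "\<And>i. i < p \<Longrightarrow> \<sigma> i = i"
  obtains \<rho> where "\<rho> permutes {..<q::nat}" "\<And>i. \<sigma> (p + i) = p + \<rho> i" "sign \<rho> = sign \<sigma>"
proof -
  let ?S = "{p..<p + q}" and ?h = "\<lambda>i. i - p"
  have \<sigma>S: "\<sigma> permutes ?S"
    by (rule permutes_superset[OF \<sigma>]) (use fx in auto)
  have "bij_betw ?h ?S {..<q}"
    by (rule bij_betw_byWitness[where f' = "\<lambda>i. p + i"]) auto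
  then have inj: "inj_on ?h ?S" and img: "?h ` ?S = {..<q}"
    by (simp_all add: bij_betw_def)
  define \<rho> where "\<rho> = map_permutation ?S ?h \<sigma>"
  have \<rho>: "\<rho> permutes {..<q}" "sign \<rho> = sign \<sigma>"
    using map_permutation_permutes[OF _ \<sigma>S, of ?h] inj img
      sign_map_permutation[OF inj \<sigma>S] by (auto simp: \<rho>_def bij_betw_def)
  have eq: "\<sigma> (p + i) = p + \<rho> i" for i
  proof (cases "i < q")
    case True
    then have "\<rho> i = \<sigma> (p + i) - p"
      using map_permutation_apply[OF inj, of "p + i" \<sigma>] by (simp add: \<rho>_def)
    moreover have "p \<le> \<sigma> (p + i)" using permutes_in_image[OF \<sigma>S, of "p + i"] True by simp
    ultimately show ?thesis by simp
  next
    case False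
    then show ?thesis using permutes_not_in[OF \<rho>(1), of i] permutes_not_in[OF \<sigma>S, of "p + i"] by simp
  qed
  show ?thesis using that \<rho> eq by simp
qed


text \<open>A permutation that moves 0 feeds one of the later vectors to \<open>a\<close>, and its
  term vanishes. For those fixing 0 the sign rule of \<omega> cancels the sign of the permutation,
  so all remaining terms are equal. Thus \<open>C\<close> is their number divided by the factorial,
  and the identity shows that it is positive.\<close>

lemma wedge_one_form_contract:
  assumes \<omega>: "alternating_form d \<omega>" and a: "\<And>i. i < d \<Longrightarrow> a (v (Suc i)) = 0"
  shows "\<exists>C>0. wedge 1 d (form1 a) \<omega> v = C * (a (v 0) * \<omega> (\<lambda>i. v (Suc i)))"
proof -
  let ?P = "{\<sigma>. \<sigma> permutes {..<1 + d}}" and ?Q = "{\<sigma>. \<sigma> permutes {..<1 + d} \<and> \<sigma> 0 = 0}"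
  let ?t = "\<lambda>\<sigma>. of_int (sign \<sigma>) * form1 a (\<lambda>i. v (\<sigma> i)) * \<omega> (\<lambda>i. v (\<sigma> (1 + i)))"
  have fin: "finite ?P" by (simp add: finite_permutations)
  have "?t \<sigma> = 0" if "\<sigma> \<in> ?P - ?Q" for \<sigma>
  proof -
    have "\<sigma> 0 < 1 + d" "\<sigma> 0 \<noteq> 0" using that permutes_in_image[of \<sigma> "{..<1 + d}" 0] by auto
    then show ?thesis using a[of "\<sigma> 0 - 1"] by (simp add: form1_def)
  qed
  moreover have "?t \<sigma> = a (v 0) * \<omega> (\<lambda>i. v (Suc i))" if "\<sigma> \<in> ?Q" for \<sigma>
  proof -
    obtain \<rho> where \<rho>: "\<rho> permutes {..<d}" "\<And>i. \<sigma> (1 + i) = 1 + \<rho> i" "sign \<rho> = sign \<sigma>"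
      using permutes_fix_initial[of \<sigma> 1 d] \<open>\<sigma> \<in> ?Q\<close> by auto
    show ?thesis
      using alternating_formD[OF \<omega> \<rho>(1), of "\<lambda>i. v (Suc i)"] \<rho>(2,3) \<open>\<sigma> \<in> ?Q\<close>
      by (simp add: form1_def sign_def)
  qed
  ultimately have "(\<Sum>\<sigma>\<in>?P. ?t \<sigma>) = (\<Sum>\<sigma>\<in>?Q. a (v 0) * \<omega> (\<lambda>i. v (Suc i)))"
    by (intro sum.mono_neutral_cong_right fin) auto
  then have "wedge 1 d (form1 a) \<omega> v = card ?Q / fact (1 + d) * (a (v 0) * \<omega> (\<lambda>i. v (Suc i)))"
    unfolding wedge_def by simp
  moreover have "card ?Q > 0"
    using finite_subset[OF _ fin, of ?Q] permutes_id[of "{..<1 + d}"]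
    by (subst card_gt_0_iff) (auto simp: id_def)
  ultimately show ?thesis by (intro exI[of _ "card ?Q / fact (1 + d)"]) simp
qed

text \<open>The 1-forms are contracted one at a time from the left. The form \<eta> \<open>a\<close>
  is 1 on the first vector and vanishes on the later \<xi> by distinctness and on \<open>w\<close>
  by assumption, so each contraction only multiplies by a positive constant.\<close>

lemma wedge_list_nonzero:
  assumes \<omega>: "alternating_form d \<omega>" "\<omega> w \<noteq> 0"
    and \<eta>: "\<And>i j. \<eta> i (\<xi> j) = (if i = j then 1 else 0)" "\<And>i j. j < d \<Longrightarrow> \<eta> i (w j) = 0"
    and "distinct is"
  shows "wedge_list (map \<eta> is) d \<omega> (\<lambda>i. if i < length is then \<xi> (is ! i) else w (i - length is)) \<noteq> 0"
  using \<open>distinct is\<close>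
proof (induction "is")
  case Nil
  then show ?case using \<omega>(2) by simp
next
  case (Cons a as)
  let ?v = "\<lambda>i. if i < length (a # as) then \<xi> ((a # as) ! i) else w (i - length (a # as))"
  have "\<eta> a (?v (Suc i)) = 0" if "i < length as + d" for i
    using Cons.prems that \<eta> by (auto simp: nth_mem)
  then obtain C where "C > 0" "wedge_list (map \<eta> (a # as)) d \<omega> ?v
      = C * (\<eta> a (?v 0) * wedge_list (map \<eta> as) d \<omega> (\<lambda>i. ?v (Suc i)))"
    using wedge_one_form_contract[OF alternating_form_wedge_list[OF \<omega>(1), of "map \<eta> as"], of "\<eta> a" ?v]
    by auto
  moreover have "(\<lambda>i. ?v (Suc i)) = (\<lambda>i. if i < length as then \<xi> (as ! i) else w (i - length as))"
    by auto
  ultimately show ?case using Cons \<eta>(1)[of a a] by simp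
qed

section \<open>Powers of a 2-form on a symplectic sequence\<close>

text \<open>A symplectic basis listed pair by pair, entries \<open>2 * i\<close> and
  \<open>2 * i + 1\<close> being conjugate. The pairings of conjugate entries are only positive, not
  normalised to 1, which makes the notion stable under positive rescaling of
  \<open>b\<close>.\<close>

definition symplectic_sequence :: "('v \<Rightarrow> 'v \<Rightarrow> real) \<Rightarrow> nat \<Rightarrow> (nat \<Rightarrow> 'v) \<Rightarrow> bool" where
  "symplectic_sequence b n v \<longleftrightarrow> (\<forall>i<n. \<forall>j<n.
     b (v (2 * i)) (v (2 * j)) = 0 \<and> b (v (2 * i + 1)) (v (2 * j + 1)) = 0 \<and>
     (if i = j then b (v (2 * i)) (v (2 * j + 1)) > 0 else b (v (2 * i)) (v (2 * j + 1)) = 0))"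

text \<open>The permutation acts only on the entries after the first pair. Rearranging them by the
  sign rule of the lower power produces the same sign again, so the signs cancel and the induction
  hypothesis applies to the sequence without its first pair.\<close>

lemma wedge_power2_term_pos_initial:
  assumes IH: "\<And>v. symplectic_sequence b n v \<Longrightarrow> wedge_power2 b n v > 0"
    and v: "symplectic_sequence b (Suc n) v"
    and \<sigma>: "\<sigma> permutes {..<2 + 2 * n}" "\<sigma> 0 = 0" "\<sigma> 1 = 1"
  shows "of_int (sign \<sigma>) * b (v (\<sigma> 0)) (v (\<sigma> 1)) * wedge_power2 b n (\<lambda>i. v (\<sigma> (2 + i))) > 0"
proof -
  have "\<sigma> i = i" if "i < 2" for i using \<sigma>(2,3) that by (cases i) auto
  then obtain \<rho> where \<rho>: "\<rho> permutes {..<2 * n}" "\<And>i. \<sigma> (2 + i) = 2 + \<rho> i" "sign \<rho> = sign \<sigma>"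
    using permutes_fix_initial[OF \<sigma>(1)] by metis
  have "symplectic_sequence b n (\<lambda>i. v (2 + i))"
    unfolding symplectic_sequence_def
  proof (intro allI impI)
    fix i j assume "i < n" "j < n"
    then show "b (v (2 + 2 * i)) (v (2 + 2 * j)) = 0 \<and> b (v (2 + (2 * i + 1))) (v (2 + (2 * j + 1))) = 0 \<and>
      (if i = j then b (v (2 + 2 * i)) (v (2 + (2 * j + 1))) > 0 else b (v (2 + 2 * i)) (v (2 + (2 * j + 1))) = 0)"
      using v[unfolded symplectic_sequence_def, rule_format, of "Suc i" "Suc j"]
      by (simp split: if_splits)
  qed
  from IH[OF this] have "wedge_power2 b n (\<lambda>i. v (2 + i)) > 0" .
  moreover have "b (v 0) (v 1) > 0"
    using v[unfolded symplectic_sequence_def, rule_format, of 0 0] by simp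
  ultimately show ?thesis
    using alternating_formD[OF alternating_form_wedge_power2 \<rho>(1), of b "\<lambda>i. v (2 + i)"] \<rho>(2,3) \<sigma>(2,3)
    by (simp add: sign_def)
qed

text \<open>Exchanging two pairs \<open>2j, 2j + 1\<close> is an even permutation and keeps a sequence symplectic, so
  every nonzero term of the sum defining the wedge product can be brought to the previous form.\<close>

lemma wedge_power2_term_pos:
  assumes IH: "\<And>v. symplectic_sequence b n v \<Longrightarrow> wedge_power2 b n v > 0"
    and v: "symplectic_sequence b (Suc n) v"
    and \<sigma>: "\<sigma> permutes {..<2 + 2 * n}" "\<sigma> 0 = 2 * i" "\<sigma> 1 = 2 * i + 1"
  shows "of_int (sign \<sigma>) * b (v (\<sigma> 0)) (v (\<sigma> 1)) * wedge_power2 b n (\<lambda>i. v (\<sigma> (2 + i))) > 0"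
proof -
  let ?N = "{..<2 + 2 * n}"
  have i: "i < Suc n" using permutes_in_image[OF \<sigma>(1), of 1] \<sigma>(3) by auto
  \<comment> \<open>For \<open>i = 0\<close> both transpositions are the identity, otherwise both
    are odd; the composition is even in either case.\<close>
  define \<tau> where "\<tau> = Transposition.transpose 0 (2 * i) \<circ> Transposition.transpose 1 (2 * i + 1)"
  have \<tau>: "\<tau> permutes ?N"
    unfolding \<tau>_def using i by (intro permutes_compose permutes_swap_id) auto
  have sgn: "sign \<tau> = 1"
    unfolding \<tau>_def by (subst sign_compose) (auto simp: permutation_swap_id sign_swap_id)
  \<comment> \<open>On the numbers of the pairs \<tau> is the transposition of 0 and
    \<open>i\<close>, and it preserves the parity of an entry; hence the symplectic conditions carry
    over.\<close>
  have \<tau>_even: "\<tau> (2 * j) = 2 * Transposition.transpose 0 i j" for j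
    unfolding \<tau>_def by (auto simp: Transposition.transpose_def, presburger)
  have \<tau>_odd: "\<tau> (2 * j + 1) = 2 * Transposition.transpose 0 i j + 1" for j
    unfolding \<tau>_def by (auto simp: Transposition.transpose_def)
  have \<tau>\<tau>: "\<tau> (\<tau> m) = m" for m
  proof (cases "even m")
    case True then show ?thesis using \<tau>_even by (auto elim!: evenE)
  next
    case False then show ?thesis using \<tau>_odd by (auto elim!: oddE)
  qed
  have v': "symplectic_sequence b (Suc n) (\<lambda>m. v (\<tau> m))"
    unfolding symplectic_sequence_def \<tau>_even \<tau>_odd
  proof (intro allI impI)
    fix j l assume jl: "j < Suc n" "l < Suc n"
    have "Transposition.transpose 0 i j < Suc n" "Transposition.transpose 0 i l < Suc n"
      using jl i by (auto simp: Transposition.transpose_def)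
    moreover have "Transposition.transpose 0 i j = Transposition.transpose 0 i l \<longleftrightarrow> j = l"
      by (metis transpose_involutory)
    ultimately show "b (v (2 * Transposition.transpose 0 i j)) (v (2 * Transposition.transpose 0 i l)) = 0 \<and>
      b (v (2 * Transposition.transpose 0 i j + 1)) (v (2 * Transposition.transpose 0 i l + 1)) = 0 \<and>
      (if j = l then b (v (2 * Transposition.transpose 0 i j)) (v (2 * Transposition.transpose 0 i l + 1)) > 0
       else b (v (2 * Transposition.transpose 0 i j)) (v (2 * Transposition.transpose 0 i l + 1)) = 0)"
      using v[unfolded symplectic_sequence_def, rule_format, of "Transposition.transpose 0 i j" "Transposition.transpose 0 i l"]
      by (simp split: if_splits)
  qed
  have \<sigma>': "\<tau> \<circ> \<sigma> permutes ?N" by (rule permutes_compose[OF \<sigma>(1) \<tau>])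
  have "(\<tau> \<circ> \<sigma>) 0 = 0" "(\<tau> \<circ> \<sigma>) 1 = 1"
    using \<sigma>(2,3) \<tau>_even[of i] \<tau>_odd[of i] by simp_all
  \<comment> \<open>As \<tau> is an involution, the term of \<tau> \<circ> \<sigma> for the
    rearranged sequence uses the vectors \<open>v (\<tau> (\<tau> (\<sigma> m)))\<close>, which are
    those of the term of \<sigma> for \<open>v\<close>; the signs agree because \<tau> is
    even.\<close>
  from wedge_power2_term_pos_initial[OF _ v' \<sigma>' this] IH show ?thesis
    using sgn sign_compose[of \<tau> \<sigma>] \<tau> \<sigma>(1) by (simp add: \<tau>\<tau> o_def permutes_lessThan_permutation)
qed

text \<open>Every term of the sum is nonnegative and the identity gives a positive one. The first
  factor \<open>b (v (\<sigma> 0)) (v (\<sigma> 1))\<close> vanishes unless the two entries form a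
  pair, in one order or the other.\<close>

lemma wedge_power2_pos:
  assumes skew: "\<And>x y. b x y = - b y x"
  shows "symplectic_sequence b n v \<Longrightarrow> wedge_power2 b n v > 0"
proof (induction n arbitrary: v)
  case (Suc n)
  let ?N = "{..<2 + 2 * n}"
  let ?t = "\<lambda>\<sigma>. of_int (sign \<sigma>) * b (v (\<sigma> 0)) (v (\<sigma> 1)) * wedge_power2 b n (\<lambda>i. v (\<sigma> (2 + i)))"
  have pos: "?t \<sigma> > 0" if "\<sigma> permutes ?N" "\<sigma> 0 = 2 * i" "\<sigma> 1 = 2 * i + 1" for \<sigma> i
    by (rule wedge_power2_term_pos[OF _ Suc.prems that]) (rule Suc.IH)
  have "?t \<sigma> \<ge> 0" if \<sigma>: "\<sigma> permutes ?N" for \<sigma>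
  proof -
    define i j where "i = \<sigma> 0 div 2" and "j = \<sigma> 1 div 2"
    have ij: "i < Suc n" "j < Suc n"
      using permutes_in_image[OF \<sigma>, of 0] permutes_in_image[OF \<sigma>, of 1] by (auto simp: i_def j_def)
    note s = Suc.prems[unfolded symplectic_sequence_def, rule_format, OF ij]
      Suc.prems[unfolded symplectic_sequence_def, rule_format, OF ij(2,1)]
    have "\<sigma> 0 = 2 * i \<or> \<sigma> 0 = 2 * i + 1" "\<sigma> 1 = 2 * j \<or> \<sigma> 1 = 2 * j + 1"
      unfolding i_def j_def by presburger+
    then consider "b (v (\<sigma> 0)) (v (\<sigma> 1)) = 0" | "\<sigma> 0 = 2 * i" "\<sigma> 1 = 2 * i + 1"
      | "\<sigma> 0 = 2 * i + 1" "\<sigma> 1 = 2 * i"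
      using s skew[of "v (2 * i + 1)" "v (2 * j)"] by (auto split: if_splits)
    then show ?thesis
    proof cases
      case 1
      then show ?thesis by simp
    next
      case 2
      then show ?thesis using pos[OF \<sigma>] by (simp add: less_imp_le)
    next
      case 3
      \<comment> \<open>Precomposing with this exchange reverses the sign of the permutation and, by
        skewness, that of the first factor. The term is unchanged, and the pair now stands in the
        right order.\<close>
      let ?s = "Transposition.transpose 0 (1::nat)"
      have "?s permutes ?N" by (rule permutes_swap_id) auto
      then have "\<sigma> \<circ> ?s permutes ?N" using \<sigma> by (rule permutes_compose)
      moreover have "(\<sigma> \<circ> ?s) 0 = 2 * i" "(\<sigma> \<circ> ?s) 1 = 2 * i + 1" using 3 by simp_all
      ultimately have "?t (\<sigma> \<circ> ?s) > 0" by (rule pos)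
      moreover have "sign (\<sigma> \<circ> ?s) = - sign \<sigma>"
        using \<sigma> by (subst sign_compose) (simp_all add: permutes_lessThan_permutation permutation_swap_id sign_swap_id)
      moreover have "?s (2 + m) = 2 + m" for m by (simp add: Transposition.transpose_def)
      ultimately show ?thesis
        using skew[of "v (\<sigma> 0)" "v (\<sigma> 1)"] by simp
    qed
  qed
  moreover have "?t id > 0" by (rule pos[where i = 0]) (simp_all add: permutes_id)
  ultimately have "(\<Sum>\<sigma> | \<sigma> permutes ?N. ?t \<sigma>) > 0"
    by (intro sum_pos2[where i = id]) (auto simp: finite_permutations permutes_id)
  then show ?case by (simp add: wedge_def form2_def)
qed simp


section \<open>Existence of symplectic sequences for a Hermitian form\<close>

text \<open>The vector \<open>r w\<close> represents the functional \<open>g w\<close> by the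
  Euclidean inner product. The span of these vectors has dimension less than \<open>DIM('e)\<close>,
  so it has a nonzero Euclidean normal vector.\<close>

lemma exists_orthogonal_to_finite:
  fixes g :: "'e::euclidean_space \<Rightarrow> 'e \<Rightarrow> real"
  assumes "bilinear g" "finite S" "card S < DIM('e)"
  shows "\<exists>u. u \<noteq> 0 \<and> (\<forall>w\<in>S. g w u = 0)"
proof -
  define r where "r w = (\<Sum>b\<in>Basis. g w b *\<^sub>R b)" for w
  have "dim (span (r ` S)) < DIM('e)"
    using dim_le_card'[of "r ` S"] card_image_le[OF assms(2), of r] assms(2,3) by (simp add: dim_span)
  then obtain u where u: "u \<noteq> 0" "\<And>w. w \<in> span (r ` S) \<Longrightarrow> orthogonal u w"
    using orthogonal_to_subspace_exists[of "span (r ` S)"] by (auto simp: span_span dim_span)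
  have "g w u = r w \<bullet> u" for w
  proof -
    have "linear (g w)" using assms(1) by (simp add: bilinear_def)
    from linear_euclidean_sum[OF this, of u] show ?thesis
      by (simp add: r_def inner_sum_left inner_commute[of u] mult.commute)
  qed
  then have "g w u = 0" if "w \<in> S" for w
    using u(2)[of "r w"] that span_base[of "r w" "r ` S"] by (simp add: orthogonal_def inner_commute)
  with u(1) show ?thesis by blast
qed

text \<open>A Gram-Schmidt type induction. The next vector is chosen orthogonal to all
  \<open>e i\<close> and \<open>J (e i)\<close>, at most \<open>2 * n\<close> vectors in a space of
  dimension at least \<open>2 * n + 2\<close>; orthogonality of its image under \<open>J\<close>
  follows because \<open>J\<close> is an isometry.\<close>

lemma exists_hermitian_orthogonal_sequence:
  fixes g :: "'e::euclidean_space \<Rightarrow> 'e \<Rightarrow> real"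
  assumes "bilinear g" "2 * n \<le> DIM('e)"
    and sym: "\<And>u v. g u v = g v u" and J: "\<And>u. J (J u) = - u" "\<And>u v. g (J u) (J v) = g u v"
  shows "\<exists>e. \<forall>i<n. e i \<noteq> 0 \<and> (\<forall>j<n. i \<noteq> j \<longrightarrow> g (e i) (e j) = 0 \<and> g (e i) (J (e j)) = 0)"
  using assms(2)
proof (induction n)
  case (Suc n)
  then obtain e where e: "\<And>i. i < n \<Longrightarrow> e i \<noteq> 0"
    "\<And>i j. i < n \<Longrightarrow> j < n \<Longrightarrow> i \<noteq> j \<Longrightarrow> g (e i) (e j) = 0 \<and> g (e i) (J (e j)) = 0"
    by auto
  let ?S = "e ` {..<n} \<union> (\<lambda>i. J (e i)) ` {..<n}"
  have "card ?S \<le> n + n"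
    by (rule order_trans[OF card_Un_le add_mono]) (use card_image_le[of "{..<n}"] in auto)
  with Suc.prems obtain u where u: "u \<noteq> 0" "\<And>i. i < n \<Longrightarrow> g (e i) u = 0" "\<And>i. i < n \<Longrightarrow> g (J (e i)) u = 0"
    using exists_orthogonal_to_finite[OF assms(1), of ?S] by auto
  have neg: "g (- x) y = - g x y" for x y using assms(1) by (simp add: bilinear_lneg)
  have "g (e i) (J u) = 0" if "i < n" for i
    using J(2)[of "J (e i)" u] u(3)[OF that] by (simp add: J(1) neg)
  then have "\<forall>i<Suc n. (e(n := u)) i \<noteq> 0 \<and> (\<forall>j<Suc n. i \<noteq> j \<longrightarrow>
      g ((e(n := u)) i) ((e(n := u)) j) = 0 \<and> g ((e(n := u)) i) (J ((e(n := u)) j)) = 0)"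
    using e u sym by (auto simp: less_Suc_eq)
  then show ?case by blast
qed simp

text \<open>Apply the isometry \<open>J\<close> to the pair \<open>u\<close>, \<open>J v\<close> and
  use that its square is minus the identity.\<close>

lemma hermitian_form_skew:
  fixes g :: "'e::euclidean_space \<Rightarrow> 'e \<Rightarrow> real"
  assumes "bilinear g" and sym: "\<And>u v. g u v = g v u"
    and J: "\<And>u. J (J u) = - u" "\<And>u v. g (J u) (J v) = g u v"
  shows "g u (J v) = - g v (J u)"
  using J(2)[of u "J v"] by (simp add: J(1) bilinear_rneg[OF assms(1)] sym[of v])

lemma exists_symplectic_sequence:
  fixes g :: "'e::euclidean_space \<Rightarrow> 'e \<Rightarrow> real"
  assumes bil: "bilinear g" and "2 * n \<le> DIM('e)" and pos: "\<And>u. u \<noteq> 0 \<Longrightarrow> g u u > 0"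
    and sym: "\<And>u v. g u v = g v u"
    and J: "\<And>u. J (J u) = - u" "\<And>u v. g (J u) (J v) = g u v" "linear J"
  shows "\<exists>v. symplectic_sequence (\<lambda>x y. g x (J y)) n v"
proof -
  note skew = hermitian_form_skew[OF bil sym J(1,2)]
  obtain e where e: "\<And>i. i < n \<Longrightarrow> e i \<noteq> 0"
    "\<And>i j. i < n \<Longrightarrow> j < n \<Longrightarrow> i \<noteq> j \<Longrightarrow> g (e i) (e j) = 0 \<and> g (e i) (J (e j)) = 0"
    using exists_hermitian_orthogonal_sequence[where J = J, OF bil assms(2) sym J(1,2)] by auto
  have z: "g (e i) (J (e j)) = 0" if "i < n" "j < n" for i j
    using e(2)[OF that] skew[of "e i" "e i"] by (cases "i = j") auto
  \<comment> \<open>The partner of \<open>e i\<close> is \<open>- J (e i)\<close>: with this sign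
    their pairing is \<open>g (e i) (J (- J (e i))) = g (e i) (e i)\<close>, which is
    positive.\<close>
  have "symplectic_sequence (\<lambda>x y. g x (J y)) n (\<lambda>m. if even m then e (m div 2) else - J (e (m div 2)))"
    unfolding symplectic_sequence_def
    using e z pos sym[of "J _"] by (auto simp: linear_neg[OF J(3)] J bilinear_lneg[OF bil] bilinear_rneg[OF bil])
  then show ?thesis by blast
qed

text \<open>Of the six permutations the two with the same argument in \<open>a\<close> give equal
  terms by skewness, so the factor 1/6 of the wedge product becomes 1/3.\<close>

lemma wedge_one_two_form:
  assumes skew: "\<And>u v. b u v = - b v u"
  shows "wedge 1 2 (form1 a) (form2 b) ((!) [x, y, z]) = (a x * b y z + a y * b z x + a z * b x y) / 3"
proof -
  have set: "{..<1 + 2::nat} = insert 0 (insert 1 {2})" by auto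
  have *: "finite {1, 2::nat}" "0 \<notin> {1, 2::nat}" "finite {2::nat}" "1 \<notin> {2::nat}" by auto
  show ?thesis
    unfolding wedge_def set sum_over_permutations_insert[OF *(1,2)] sum_over_permutations_insert[OF *(3,4)]
      permutes_sing
    using skew[of z y] skew[of x z] skew[of y x]
    by (simp add: sign_swap_id sign_compose permutation_swap_id permutation_compose sign_id form1_def form2_def
        Transposition.transpose_def fact_numeral)
qed


section \<open>Tensor fields in charts\<close>

lemma chart_inv_map: "is_chart c \<Longrightarrow> p \<in> chart_dom c \<Longrightarrow> chart_inv c (chart_map c p) = p"
  by (auto simp: is_chart_def homeomorphism_def)

lemma chart_map_inv: "is_chart c \<Longrightarrow> y \<in> chart_map c ` chart_dom c \<Longrightarrow> chart_map c (chart_inv c y) = y"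
  by (auto simp: is_chart_def homeomorphism_def)

lemma chart_inv_in: "is_chart c \<Longrightarrow> y \<in> chart_map c ` chart_dom c \<Longrightarrow> chart_inv c y \<in> chart_dom c"
  by (auto simp: chart_inv_map)

lemma chart_map_inj: "is_chart c \<Longrightarrow> inj_on (chart_map c) (chart_dom c)"
  by (metis chart_inv_map inj_onI)

lemma open_chart_image:
  assumes c: "is_chart c" and U: "open U"
  shows "open (chart_map c ` (U \<inter> chart_dom c))"
proof -
  let ?Y = "chart_map c ` chart_dom c"
  have "continuous_on ?Y (chart_inv c)" "open ?Y"
    using c by (auto simp: is_chart_def homeomorphism_def)
  then have "open (chart_inv c -` U \<inter> ?Y)"
    using U by (simp add: continuous_on_open_vimage)
  moreover have "chart_inv c -` U \<inter> ?Y = chart_map c ` (U \<inter> chart_dom c)"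
    using c by (auto simp: chart_inv_map)
  ultimately show ?thesis by simp
qed

lemma chart_image_Int:
  assumes "is_chart c" "y \<in> chart_map c ` (U \<inter> chart_dom c)"
  shows "chart_inv c y \<in> U" "chart_inv c y \<in> chart_dom c" "chart_map c (chart_inv c y) = y"
  using assms by (auto simp: chart_inv_map)

text \<open>The Jacobian at \<open>p\<close> of the transition map from \<open>c\<close> to
  \<open>d\<close>.\<close>

definition coord_change :: "('m, 'e::euclidean_space) chart \<Rightarrow> ('m, 'e) chart \<Rightarrow> 'm \<Rightarrow> 'e \<Rightarrow> 'e" where
  "coord_change c d p = frechet_derivative (chart_map d \<circ> chart_inv c) (at (chart_map c p))"

lemma tangent_coord_eq: "tangent_coord M c p = coord_change (base_chart M p) c p"
  by (simp add: tangent_coord_def coord_change_def)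

locale smooth_mfd =
  fixes M :: "('m::{t2_space,second_countable_topology}, 'e::euclidean_space) manifold"
  assumes smooth_manifold: "smooth_manifold M"
begin

lemma is_chart: "c \<in> atlas M \<Longrightarrow> is_chart c"
  using smooth_manifold by (auto simp: smooth_manifold_def)

lemma base_chart: "base_chart M p \<in> atlas M" "p \<in> chart_dom (base_chart M p)"
  using smooth_manifold by (auto simp: smooth_manifold_def)

lemma open_image: "c \<in> atlas M \<Longrightarrow> open U \<Longrightarrow> open (chart_map c ` (U \<inter> chart_dom c))"
  by (simp add: open_chart_image is_chart)

lemma open_dom: "c \<in> atlas M \<Longrightarrow> open (chart_dom c)"
  using is_chart by (auto simp: is_chart_def)

lemma smooth_transition:
  "c \<in> atlas M \<Longrightarrow> d \<in> atlas M \<Longrightarrow>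
    smooth_on (chart_map c ` (chart_dom c \<inter> chart_dom d)) (chart_map d \<circ> chart_inv c)"
  using smooth_manifold by (auto simp: smooth_manifold_def)

lemma transition_differentiable:
  assumes "c \<in> atlas M" "d \<in> atlas M" "p \<in> chart_dom c" "p \<in> chart_dom d"
  shows "(chart_map d \<circ> chart_inv c) differentiable at (chart_map c p)"
  by (rule smooth_on_differentiable[OF smooth_transition]) (use assms in auto)

lemma has_derivative_transition:
  assumes "c \<in> atlas M" "d \<in> atlas M" "p \<in> chart_dom c" "p \<in> chart_dom d"
  shows "(chart_map d \<circ> chart_inv c has_derivative coord_change c d p) (at (chart_map c p))"
  unfolding coord_change_def by (rule has_derivative_frechet[OF transition_differentiable[OF assms]])

lemma coord_change_linear:
  assumes "c \<in> atlas M" "d \<in> atlas M" "p \<in> chart_dom c" "p \<in> chart_dom d"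
  shows "linear (coord_change c d p)"
  using has_derivative_linear[OF has_derivative_transition[OF assms]] .

lemma coord_change_same:
  assumes "c \<in> atlas M" "p \<in> chart_dom c"
  shows "coord_change c c p = (\<lambda>v. v)"
proof -
  have "frechet_derivative (chart_map c \<circ> chart_inv c) (at (chart_map c p))
      = frechet_derivative (\<lambda>y. y) (at (chart_map c p))"
    by (rule frechet_derivative_cong_open[of "chart_map c ` (UNIV \<inter> chart_dom c)"])
      (use assms open_image[OF assms(1), of UNIV] chart_map_inv[OF is_chart] in auto)
  then show ?thesis by (simp add: coord_change_def frechet_derivative_eqI)
qed

text \<open>The cocycle rule for Jacobians: the chain rule for the transition maps, which compose
  correctly on the open image of the common domain of the three charts.\<close>

lemma coord_change_trans:
  assumes cde: "c \<in> atlas M" "d \<in> atlas M" "e \<in> atlas M"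
    and p: "p \<in> chart_dom c" "p \<in> chart_dom d" "p \<in> chart_dom e"
  shows "coord_change d e p (coord_change c d p v) = coord_change c e p v"
proof -
  let ?S = "chart_map c ` ((chart_dom d \<inter> chart_dom e) \<inter> chart_dom c)"
  have "((chart_map e \<circ> chart_inv d) \<circ> (chart_map d \<circ> chart_inv c) has_derivative
      coord_change d e p \<circ> coord_change c d p) (at (chart_map c p))"
    by (rule diff_chain_at) (use has_derivative_transition cde p chart_inv_map[OF is_chart] in auto)
  then have "(chart_map e \<circ> chart_inv c has_derivative coord_change d e p \<circ> coord_change c d p)
      (at (chart_map c p))"
  proof (rule has_derivative_transform_within_open)
    show "open ?S" by (intro open_image cde open_Int open_dom)
    show "chart_map c p \<in> ?S" using p by auto
    show "((chart_map e \<circ> chart_inv d) \<circ> (chart_map d \<circ> chart_inv c)) y = (chart_map e \<circ> chart_inv c) y"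
      if "y \<in> ?S" for y
      using that cde by (auto simp: chart_inv_map is_chart)
  qed
  then show ?thesis unfolding coord_change_def[of c e]
    by (simp add: frechet_derivative_eqI)
qed

section \<open>Coordinate vector fields\<close>

text \<open>The field with constant components \<open>v\<close> in the chart \<open>c\<close>.
  Tangent vectors at \<open>p\<close> are written in \<open>base_chart M p\<close>, hence the
  coordinate change to that chart, which varies with the point.\<close>

definition coord_field :: "('m, 'e) chart \<Rightarrow> 'e \<Rightarrow> 'm \<Rightarrow> 'e" where
  "coord_field c v p = coord_change c (base_chart M p) p v"

lemma tangent_coord_linear: "c \<in> atlas M \<Longrightarrow> p \<in> chart_dom c \<Longrightarrow> linear (tangent_coord M c p)"
  by (simp add: tangent_coord_eq coord_change_linear base_chart)

lemma tangent_coord_base: "tangent_coord M (base_chart M p) p v = v"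
  by (simp add: tangent_coord_eq coord_change_same base_chart)

lemma coord_field_linear:
  "c \<in> atlas M \<Longrightarrow> p \<in> chart_dom c \<Longrightarrow> linear (\<lambda>v. coord_field c v p)"
  unfolding coord_field_def by (simp add: coord_change_linear base_chart)

lemma coord_field_base: "coord_field (base_chart M p) v p = v"
  by (simp add: coord_field_def coord_change_same base_chart)

lemma tangent_coord_coord_field:
  "c \<in> atlas M \<Longrightarrow> d \<in> atlas M \<Longrightarrow> p \<in> chart_dom c \<Longrightarrow> p \<in> chart_dom d \<Longrightarrow>
    tangent_coord M d p (coord_field c v p) = coord_change c d p v"
  by (simp add: tangent_coord_eq coord_field_def coord_change_trans base_chart)

lemma coord_field_tangent_coord:
  "c \<in> atlas M \<Longrightarrow> p \<in> chart_dom c \<Longrightarrow> coord_field c (tangent_coord M c p v) p = v"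
  by (simp add: tangent_coord_eq coord_field_def coord_change_trans base_chart coord_change_same)

text \<open>In another chart \<open>d\<close> the components are the derivative of the transition
  map from \<open>c\<close> to \<open>d\<close> in the fixed direction \<open>v\<close>, taken at
  the corresponding point of \<open>c\<close>. These fields are the local test fields for extracting
  components of tensor fields.\<close>

lemma vector_field_coord_field:
  assumes c: "c \<in> atlas M"
  shows "vector_field_on M (chart_dom c) (coord_field c v)"
  unfolding vector_field_on_def
proof (intro conjI ballI open_dom c)
  fix d assume d: "d \<in> atlas M"
  let ?S = "chart_map d ` (chart_dom c \<inter> chart_dom d)" and ?T = "chart_map c ` (chart_dom d \<inter> chart_dom c)"
  have S: "open ?S" "open ?T" by (intro open_image open_dom c d)+
  have "smooth_on ?S ((\<lambda>y. frechet_derivative (chart_map d \<circ> chart_inv c) (at y) v) \<circ> (chart_map c \<circ> chart_inv d))"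
  proof (rule smooth_on_compose[OF S])
    show "(chart_map c \<circ> chart_inv d) ` ?S \<subseteq> ?T"
      using d by (auto simp: chart_inv_map is_chart)
    show "smooth_on ?S (chart_map c \<circ> chart_inv d)"
      using smooth_transition[OF d c] by (simp add: Int_commute)
    show "smooth_on ?T (\<lambda>y. frechet_derivative (chart_map d \<circ> chart_inv c) (at y) v)"
      using smooth_on_frechet[OF smooth_transition[OF c d]] by (simp add: Int_commute)
  qed
  then show "smooth_on ?S (vector_field_rep M d (coord_field c v))"
  proof (rule smooth_on_cong[OF _ S(1)])
    fix z assume "z \<in> ?S"
    note z = chart_image_Int[OF is_chart[OF d] this]
    show "((\<lambda>y. frechet_derivative (chart_map d \<circ> chart_inv c) (at y) v) \<circ> (chart_map c \<circ> chart_inv d)) z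
        = vector_field_rep M d (coord_field c v) z"
      using z c d by (simp add: vector_field_rep_def tangent_coord_coord_field coord_change_def)
  qed
qed

section \<open>Components of endomorphisms and bilinear forms\<close>

text \<open>The matrix of \<phi> in the chart \<open>c\<close> at the point with coordinates
  \<open>y\<close>, as a map on component vectors.\<close>

definition endo_rep :: "('m \<Rightarrow> 'e \<Rightarrow> 'e) \<Rightarrow> ('m, 'e) chart \<Rightarrow> 'e \<Rightarrow> 'e \<Rightarrow> 'e" where
  "endo_rep \<phi> c y v = vector_field_rep M c (\<lambda>p. \<phi> p (coord_field c v p)) y"

definition form_rep :: "('m \<Rightarrow> 'e \<Rightarrow> 'e \<Rightarrow> real) \<Rightarrow> ('m, 'e) chart \<Rightarrow> 'e \<Rightarrow> 'e \<Rightarrow> 'e \<Rightarrow> real" where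
  "form_rep \<omega> c y u v =
     \<omega> (chart_inv c y) (coord_field c u (chart_inv c y)) (coord_field c v (chart_inv c y))"

lemma vector_field_rep_endo:
  assumes c: "c \<in> atlas M" "z \<in> chart_map c ` chart_dom c"
  shows "vector_field_rep M c (\<lambda>p. \<phi> p (X p)) z = endo_rep \<phi> c z (vector_field_rep M c X z)"
  using chart_inv_in[OF is_chart[OF c(1)] c(2)] c
  by (simp add: endo_rep_def vector_field_rep_def coord_field_tangent_coord)

lemma form_rep_vector_field:
  assumes c: "c \<in> atlas M" "z \<in> chart_map c ` chart_dom c"
  shows "\<omega> (chart_inv c z) (X (chart_inv c z)) (Y (chart_inv c z))
    = form_rep \<omega> c z (vector_field_rep M c X z) (vector_field_rep M c Y z)"
  using chart_inv_in[OF is_chart[OF c(1)] c(2)] c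
  by (simp add: form_rep_def vector_field_rep_def coord_field_tangent_coord)

lemma endo_rep_base:
  "endo_rep \<phi> (base_chart M p) (chart_map (base_chart M p) p) v = \<phi> p v"
  by (simp add: endo_rep_def vector_field_rep_def chart_inv_map is_chart base_chart
      tangent_coord_base coord_field_base)

lemma form_rep_base:
  "form_rep \<omega> (base_chart M p) (chart_map (base_chart M p) p) u v = \<omega> p u v"
  by (simp add: form_rep_def chart_inv_map is_chart base_chart coord_field_base)

lemma endo_rep_linear:
  assumes "smooth_endomorphism M \<phi>" and c: "c \<in> atlas M" "z \<in> chart_map c ` chart_dom c"
  shows "linear (endo_rep \<phi> c z)"
proof -
  have p: "chart_inv c z \<in> chart_dom c" using chart_inv_in[OF is_chart[OF c(1)] c(2)] .
  have "linear (\<phi> (chart_inv c z))" using assms(1) by (simp add: smooth_endomorphism_def)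
  from linear_compose[OF linear_compose[OF coord_field_linear[OF c(1) p] this] tangent_coord_linear[OF c(1) p]]
  show ?thesis by (simp add: endo_rep_def[abs_def] vector_field_rep_def o_def)
qed

definition smooth_bilinear_form :: "('m \<Rightarrow> 'e \<Rightarrow> 'e \<Rightarrow> real) \<Rightarrow> bool" where
  "smooth_bilinear_form \<omega> \<longleftrightarrow> (\<forall>p. bilinear (\<omega> p)) \<and>
     (\<forall>U X Y. vector_field_on M U X \<and> vector_field_on M U Y \<longrightarrow>
        smooth_function_on M U (\<lambda>p. \<omega> p (X p) (Y p)))"

lemma form_rep_bilinear:
  assumes "smooth_bilinear_form \<omega>" and c: "c \<in> atlas M" "z \<in> chart_map c ` chart_dom c"
  shows "bilinear (form_rep \<omega> c z)"
proof -
  have p: "chart_inv c z \<in> chart_dom c" using chart_inv_in[OF is_chart[OF c(1)] c(2)] .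
  have L: "linear (\<omega> (chart_inv c z) u)" "linear (\<lambda>u. \<omega> (chart_inv c z) u v)" for u v
    using assms(1) by (auto simp: smooth_bilinear_form_def bilinear_def)
  show ?thesis unfolding bilinear_def form_rep_def
    using linear_compose[OF coord_field_linear[OF c(1) p] L(1)]
      linear_compose[OF coord_field_linear[OF c(1) p] L(2)]
    by (auto simp: o_def)
qed

text \<open>Smoothness of \<phi> is a condition on vector fields over arbitrary open sets; it is
  tested on the coordinate field over the chart domain.\<close>

lemma endo_rep_smooth:
  assumes "smooth_endomorphism M \<phi>" and c: "c \<in> atlas M"
  shows "smooth_on (chart_map c ` chart_dom c) (\<lambda>z. endo_rep \<phi> c z v)"
proof -
  have "vector_field_on M (chart_dom c) (\<lambda>p. \<phi> p (coord_field c v p))"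
    using assms vector_field_coord_field[OF c, of v] by (simp add: smooth_endomorphism_def)
  then show ?thesis using c by (auto simp: vector_field_on_def endo_rep_def)
qed

lemma form_rep_smooth:
  assumes "smooth_bilinear_form \<omega>" and c: "c \<in> atlas M"
  shows "smooth_on (chart_map c ` chart_dom c) (\<lambda>z. form_rep \<omega> c z u v)"
proof -
  have "smooth_function_on M (chart_dom c) (\<lambda>p. \<omega> p (coord_field c u p) (coord_field c v p))"
    using assms(1) vector_field_coord_field[OF c] unfolding smooth_bilinear_form_def by blast
  then show ?thesis using c by (auto simp: smooth_function_on_def form_rep_def[abs_def] o_def)
qed

lemma base_open: "open (chart_map (base_chart M p) ` chart_dom (base_chart M p))"
  using open_image[OF base_chart(1), of UNIV] by simp

lemma vector_field_rep_base:
  "vector_field_rep M (base_chart M p) X (chart_map (base_chart M p) p) = X p"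
  by (simp add: vector_field_rep_def chart_inv_map is_chart base_chart tangent_coord_base)

lemma vector_field_rep_has_derivative:
  assumes "vector_field_on M U X" "p \<in> U"
  shows "(vector_field_rep M (base_chart M p) X has_derivative
     frechet_derivative (vector_field_rep M (base_chart M p) X) (at (chart_map (base_chart M p) p)))
     (at (chart_map (base_chart M p) p))"
  by (rule has_derivative_frechet, rule smooth_on_differentiable[of "chart_map (base_chart M p) ` (U \<inter> chart_dom (base_chart M p))"])
    (use assms base_chart[of p] in \<open>auto simp: vector_field_on_def\<close>)

section \<open>Torsion and exterior derivative in terms of components\<close>

text \<open>Derivatives of components in the base chart at \<open>p\<close>, with the direction of
  differentiation as the last argument. They depend on that chart and are not tensors.\<close>

definition endo_deriv :: "('m \<Rightarrow> 'e \<Rightarrow> 'e) \<Rightarrow> 'm \<Rightarrow> 'e \<Rightarrow> 'e \<Rightarrow> 'e" where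
  "endo_deriv \<phi> p v = frechet_derivative (\<lambda>z. endo_rep \<phi> (base_chart M p) z v) (at (chart_map (base_chart M p) p))"

definition form_deriv :: "('m \<Rightarrow> 'e \<Rightarrow> 'e \<Rightarrow> real) \<Rightarrow> 'm \<Rightarrow> 'e \<Rightarrow> 'e \<Rightarrow> 'e \<Rightarrow> real" where
  "form_deriv \<omega> p u v = frechet_derivative (\<lambda>z. form_rep \<omega> (base_chart M p) z u v) (at (chart_map (base_chart M p) p))"

lemma base_chart_image: "chart_map (base_chart M p) p \<in> chart_map (base_chart M p) ` chart_dom (base_chart M p)"
  using base_chart(2) by blast

lemma endo_rep_has_derivative:
  assumes "smooth_endomorphism M \<phi>"
  shows "((\<lambda>z. endo_rep \<phi> (base_chart M p) z v) has_derivative endo_deriv \<phi> p v)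
    (at (chart_map (base_chart M p) p))"
  unfolding endo_deriv_def
  by (intro has_derivative_frechet smooth_on_differentiable[OF endo_rep_smooth[OF assms base_chart(1)]]
      base_chart_image)

lemma form_rep_has_derivative:
  assumes "smooth_bilinear_form \<omega>"
  shows "((\<lambda>z. form_rep \<omega> (base_chart M p) z u v) has_derivative form_deriv \<omega> p u v)
    (at (chart_map (base_chart M p) p))"
  unfolding form_deriv_def
  by (intro has_derivative_frechet smooth_on_differentiable[OF form_rep_smooth[OF assms base_chart(1)]]
      base_chart_image)

definition field_deriv :: "('m \<Rightarrow> 'e) \<Rightarrow> 'm \<Rightarrow> 'e \<Rightarrow> 'e" where
  "field_deriv X p = frechet_derivative (vector_field_rep M (base_chart M p) X) (at (chart_map (base_chart M p) p))"

lemma lie_bracket_eq: "lie_bracket M X Y p = field_deriv Y p (X p) - field_deriv X p (Y p)"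
  by (simp add: lie_bracket_def field_deriv_def Let_def)

lemma field_has_derivative:
  "vector_field_on M U X \<Longrightarrow> p \<in> U \<Longrightarrow>
    (vector_field_rep M (base_chart M p) X has_derivative field_deriv X p) (at (chart_map (base_chart M p) p))"
  unfolding field_deriv_def by (rule vector_field_rep_has_derivative)

lemma field_deriv_endo:
  assumes \<phi>: "smooth_endomorphism M \<phi>" and X: "vector_field_on M U X" "p \<in> U"
  shows "field_deriv (\<lambda>q. \<phi> q (X q)) p w = endo_deriv \<phi> p (X p) w + \<phi> p (field_deriv X p w)"
proof -
  let ?c = "base_chart M p" and ?r = "vector_field_rep M (base_chart M p)"
  let ?y = "chart_map ?c p"
  have "((\<lambda>z. endo_rep \<phi> ?c z (?r X z)) has_derivative
      (\<lambda>w. endo_deriv \<phi> p (?r X ?y) w + endo_rep \<phi> ?c ?y (field_deriv X p w))) (at ?y)"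
    by (rule has_derivative_linear_family[OF base_open base_chart_image _ _ field_has_derivative[OF X]])
      (use \<phi> base_chart(1) in \<open>auto intro: endo_rep_linear endo_rep_has_derivative\<close>)
  then have "(?r (\<lambda>q. \<phi> q (X q)) has_derivative
      (\<lambda>w. endo_deriv \<phi> p (?r X ?y) w + endo_rep \<phi> ?c ?y (field_deriv X p w))) (at ?y)"
    by (rule has_derivative_transform_within_open[OF _ base_open base_chart_image])
      (simp add: vector_field_rep_endo base_chart)
  then show ?thesis
    by (simp add: field_deriv_def frechet_derivative_eqI endo_rep_base vector_field_rep_base)
qed

text \<open>Each bracket is a difference of field derivatives, and \<open>field_deriv_endo\<close>
  splits those of \<phi> \<open>X\<close> and \<phi> \<open>Y\<close>. All derivatives of
  \<open>X\<close> and \<open>Y\<close> then cancel by linearity of \<phi>, which leaves an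
  expression in the values of the fields at \<open>p\<close>.\<close>

lemma nijenhuis_eq:
  assumes \<phi>: "smooth_endomorphism M \<phi>"
    and X: "vector_field_on M U X" and Y: "vector_field_on M U Y" and p: "p \<in> U"
  shows "nijenhuis M \<phi> X Y p = endo_deriv \<phi> p (Y p) (\<phi> p (X p)) - endo_deriv \<phi> p (X p) (\<phi> p (Y p))
    + \<phi> p (endo_deriv \<phi> p (X p) (Y p)) - \<phi> p (endo_deriv \<phi> p (Y p) (X p))"
proof -
  have "linear (\<phi> p)" using \<phi> by (simp add: smooth_endomorphism_def)
  then show ?thesis
    unfolding nijenhuis_def lie_bracket_eq
    by (simp add: field_deriv_endo[OF \<phi> X p] field_deriv_endo[OF \<phi> Y p] linear_diff linear_add)
qed

lemma vf_apply_form: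
  assumes \<omega>: "smooth_bilinear_form \<omega>"
    and Y: "vector_field_on M U Y" and Z: "vector_field_on M U Z" and p: "p \<in> U"
  shows "vf_apply M X (\<lambda>q. \<omega> q (Y q) (Z q)) p = form_deriv \<omega> p (Y p) (Z p) (X p)
    + \<omega> p (Y p) (field_deriv Z p (X p)) + \<omega> p (field_deriv Y p (X p)) (Z p)"
proof -
  let ?c = "base_chart M p" and ?r = "vector_field_rep M (base_chart M p)"
  let ?y = "chart_map ?c p"
  have "((\<lambda>z. form_rep \<omega> ?c z (?r Y z) (?r Z z)) has_derivative
      (\<lambda>w. form_deriv \<omega> p (?r Y ?y) (?r Z ?y) w + form_rep \<omega> ?c ?y (?r Y ?y) (field_deriv Z p w)
        + form_rep \<omega> ?c ?y (field_deriv Y p w) (?r Z ?y))) (at ?y)"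
    by (rule has_derivative_bilinear_family[OF base_open base_chart_image _ _
          field_has_derivative[OF Y p] field_has_derivative[OF Z p]])
      (use \<omega> base_chart(1) in \<open>auto intro: form_rep_bilinear form_rep_has_derivative\<close>)
  then have "((\<lambda>q. \<omega> q (Y q) (Z q)) \<circ> chart_inv ?c has_derivative
      (\<lambda>w. form_deriv \<omega> p (?r Y ?y) (?r Z ?y) w + form_rep \<omega> ?c ?y (?r Y ?y) (field_deriv Z p w)
        + form_rep \<omega> ?c ?y (field_deriv Y p w) (?r Z ?y))) (at ?y)"
    by (rule has_derivative_transform_within_open[OF _ base_open base_chart_image])
      (simp add: form_rep_vector_field base_chart)
  then show ?thesis
    by (simp add: vf_apply_def differential_def frechet_derivative_eqI form_rep_base vector_field_rep_base)
qed

text \<open>The Leibniz rule \<open>vf_apply_form\<close> produces the derivatives of the fields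
  once more than the brackets do, with the opposite sign up to skewness of \<omega>; only the cyclic
  sum of the derivatives of the components is left.\<close>

lemma ext_deriv2_eq:
  assumes \<omega>: "smooth_bilinear_form \<omega>" and skew: "\<And>u v. \<omega> p u v = - \<omega> p v u"
    and X: "vector_field_on M U X" and Y: "vector_field_on M U Y" and Z: "vector_field_on M U Z"
    and p: "p \<in> U"
  shows "ext_deriv2 M \<omega> X Y Z p = (form_deriv \<omega> p (Y p) (Z p) (X p)
    + form_deriv \<omega> p (Z p) (X p) (Y p) + form_deriv \<omega> p (X p) (Y p) (Z p)) / 3"
proof -
  note d = vf_apply_form[OF \<omega> _ _ p]
  show ?thesis
    unfolding ext_deriv2_def lie_bracket_eq d[OF Y Z] d[OF Z X] d[OF X Y] bilinear_lsub[OF \<omega>[unfolded smooth_bilinear_form_def, THEN conjunct1, rule_format]]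
    using skew[of "Y p"] skew[of "Z p"] skew[of "X p"] by simp
qed

lemma coord_field_at_base: "vector_field_on M (chart_dom (base_chart M p)) (coord_field (base_chart M p) v)"
  by (rule vector_field_coord_field[OF base_chart(1)])

lemma smooth_bilinear_form_metric: "riemannian_metric M g \<Longrightarrow> smooth_bilinear_form g"
  by (simp add: riemannian_metric_def smooth_bilinear_form_def)

lemma smooth_bilinear_form_fundamental:
  assumes g: "riemannian_metric M g" and \<phi>: "smooth_endomorphism M \<phi>"
  shows "smooth_bilinear_form (fundamental_form g \<phi>)"
  unfolding smooth_bilinear_form_def fundamental_form_def
proof (intro conjI allI impI; (elim conjE)?)
  fix p
  have b: "bilinear (g p)" and l: "linear (\<phi> p)"
    using g \<phi> by (simp_all add: riemannian_metric_def smooth_endomorphism_def)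
  show "bilinear (\<lambda>u v. g p u (\<phi> p v))"
    unfolding bilinear_def
    by (auto intro!: linearI simp: bilinear_ladd[OF b] bilinear_radd[OF b] bilinear_lmul[OF b]
        bilinear_rmul[OF b] linear_add[OF l] linear_scale[OF l])
qed (use g \<phi> in \<open>auto simp: riemannian_metric_def smooth_endomorphism_def\<close>)

text \<open>Coordinate fields of the base chart take arbitrary values at \<open>p\<close>. The
  condition on vector fields becomes an identity for tangent vectors, which applies also to the
  second components of a field on the product.\<close>

lemma torsion_free_endo_deriv:
  assumes \<phi>: "smooth_endomorphism M \<phi>"
    and torsion: "\<And>U X Y p. vector_field_on M U X \<Longrightarrow> vector_field_on M U Y \<Longrightarrow> p \<in> U \<Longrightarrow>
      nijenhuis M \<phi> X Y p = 0"
  shows "endo_deriv \<phi> p v (\<phi> p u) - endo_deriv \<phi> p u (\<phi> p v)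
    + \<phi> p (endo_deriv \<phi> p u v) - \<phi> p (endo_deriv \<phi> p v u) = 0"
  using torsion[OF coord_field_at_base coord_field_at_base base_chart(2), of p u v]
    nijenhuis_eq[OF \<phi> coord_field_at_base coord_field_at_base base_chart(2), of p u v]
  by (simp add: coord_field_base)

text \<open>As for the torsion, coordinate fields turn closedness into a pointwise identity for
  three tangent vectors.\<close>

lemma closed_form_deriv:
  assumes \<omega>: "smooth_bilinear_form \<omega>" and skew: "\<And>u v. \<omega> p u v = - \<omega> p v u"
    and closed: "\<And>U X Y Z p. vector_field_on M U X \<Longrightarrow> vector_field_on M U Y \<Longrightarrow>
      vector_field_on M U Z \<Longrightarrow> p \<in> U \<Longrightarrow> ext_deriv2 M \<omega> X Y Z p = 0"
  shows "form_deriv \<omega> p v w u + form_deriv \<omega> p w u v + form_deriv \<omega> p u v w = 0"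
  using closed[OF coord_field_at_base coord_field_at_base coord_field_at_base base_chart(2), of p u v w]
    ext_deriv2_eq[OF \<omega> skew coord_field_at_base coord_field_at_base coord_field_at_base base_chart(2), of u v w]
  by (simp add: coord_field_base)

end


section \<open>The product of a Euclidean space and a manifold\<close>

definition euclidean_chart :: "('v, 'v) chart" where
  "euclidean_chart = \<lparr>chart_dom = UNIV, chart_map = id\<rparr>"

definition lift_chart :: "('m, 'e) chart \<Rightarrow> ('v \<times> 'm, 'v \<times> 'e) chart" where
  "lift_chart c = prod_chart euclidean_chart c"

lemma chart_dom_lift: "chart_dom (lift_chart c) = UNIV \<times> chart_dom c"
  by (simp add: lift_chart_def euclidean_chart_def prod_chart_def)

lemma chart_map_lift: "chart_map (lift_chart c) = map_prod id (chart_map c)"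
  by (simp add: lift_chart_def euclidean_chart_def prod_chart_def)

lemma lift_chart_image:
  "chart_map (lift_chart c) ` chart_dom (lift_chart c) = UNIV \<times> chart_map c ` chart_dom c"
  by (force simp: chart_dom_lift chart_map_lift)

lemma inj_on_lift_chart: "inj_on (chart_map c) (chart_dom c) \<Longrightarrow> inj_on (chart_map (lift_chart c)) (chart_dom (lift_chart c))"
  by (auto simp: inj_on_def chart_dom_lift chart_map_lift)

text \<open>\<open>chart_inv\<close> is defined through \<open>inv_into\<close>, so its value is
  found from injectivity of the lifted chart on its domain.\<close>

lemma chart_inv_lift:
  assumes "is_chart c" "y \<in> chart_map c ` chart_dom c"
  shows "chart_inv (lift_chart c) (t, y) = (t, chart_inv c y)"
  unfolding chart_inv_def[of "lift_chart c"]
  by (rule inv_into_f_eq[OF inj_on_lift_chart[OF chart_map_inj[OF assms(1)]]])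
    (use assms in \<open>auto simp: chart_dom_lift chart_map_lift chart_inv_map\<close>)

lemma is_chart_lift:
  fixes c :: "('m::topological_space, 'e::euclidean_space) chart"
  assumes c: "is_chart c"
  shows "is_chart (lift_chart c :: ('v::euclidean_space \<times> 'm, 'v \<times> 'e) chart)"
proof -
  let ?l = "lift_chart c :: ('v \<times> 'm, 'v \<times> 'e) chart" and ?Y = "chart_map c ` chart_dom c"
  have h: "homeomorphism (chart_dom c) ?Y (chart_map c) (chart_inv c)" and o: "open (chart_dom c)" "open ?Y"
    using c by (auto simp: is_chart_def)
  have "homeomorphism (UNIV \<times> chart_dom c) (UNIV \<times> ?Y) (chart_map ?l) (chart_inv ?l)"
    unfolding homeomorphism_def
  proof (intro conjI)
    show "continuous_on (UNIV \<times> chart_dom c) (chart_map ?l)"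
      unfolding chart_map_lift map_prod_def case_prod_unfold id_def
      by (intro continuous_intros continuous_on_compose2[OF homeomorphism_cont1[OF h]]) auto
    have "continuous_on (UNIV \<times> ?Y) (\<lambda>z::'v \<times> 'e. (fst z, chart_inv c (snd z)))"
      by (intro continuous_intros continuous_on_compose2[OF homeomorphism_cont2[OF h]]) auto
    then show "continuous_on (UNIV \<times> ?Y) (chart_inv ?l)"
      by (rule continuous_on_eq) (auto simp: chart_inv_lift c chart_inv_map)
    show "chart_map ?l ` (UNIV \<times> chart_dom c) = UNIV \<times> ?Y"
      using lift_chart_image[of c] by (simp add: chart_dom_lift)
    show "chart_inv ?l ` (UNIV \<times> ?Y) = UNIV \<times> chart_dom c"
    proof (intro equalityI subsetI)
      fix z :: "'v \<times> 'm" assume "z \<in> UNIV \<times> chart_dom c"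
      then show "z \<in> chart_inv ?l ` (UNIV \<times> ?Y)"
        by (intro image_eqI[of _ _ "(fst z, chart_map c (snd z))"]) (auto simp: chart_inv_lift c chart_inv_map)
    qed (auto simp: chart_inv_lift c chart_inv_map)
  qed (auto simp: chart_inv_lift c chart_inv_map chart_map_lift)
  then show ?thesis
    using o unfolding is_chart_def lift_chart_image by (simp add: chart_dom_lift open_Times)
qed

abbreviation (input) cylinder :: "('m, 'e) manifold \<Rightarrow> ('v::euclidean_space \<times> 'm, 'v \<times> 'e) manifold" where
  "cylinder M \<equiv> prod_manifold euclidean_manifold M"

lemma atlas_cylinder: "atlas (cylinder M) = lift_chart ` atlas M"
  by (auto simp: prod_manifold_def euclidean_manifold_def lift_chart_def euclidean_chart_def)

lemma base_chart_cylinder: "base_chart (cylinder M) p = lift_chart (base_chart M (snd p))"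
  by (simp add: prod_manifold_def euclidean_manifold_def lift_chart_def euclidean_chart_def case_prod_unfold)

context smooth_mfd
begin

lemma open_lift_image:
  "c \<in> atlas M \<Longrightarrow> open (UNIV \<times> chart_map c ` chart_dom c)"
  using open_image[of c UNIV] by (simp add: open_Times)

lemma smooth_manifold_cylinder:
  "smooth_manifold (cylinder M :: ('v::euclidean_space \<times> 'm, 'v \<times> 'e) manifold)"
  unfolding smooth_manifold_def atlas_cylinder
proof (intro conjI ballI allI)
  let ?l = "lift_chart :: ('m, 'e) chart \<Rightarrow> ('v \<times> 'm, 'v \<times> 'e) chart"
  fix c' assume "c' \<in> ?l ` atlas M"
  then obtain c where c: "c \<in> atlas M" "c' = ?l c" by blast
  then show "is_chart c'" by (simp add: is_chart_lift is_chart)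
  fix d' assume "d' \<in> ?l ` atlas M"
  then obtain d where d: "d \<in> atlas M" "d' = ?l d" by blast
  let ?S = "chart_map c ` (chart_dom d \<inter> chart_dom c)"
  have S: "open ?S" by (intro open_image open_dom c d)
  then have US: "open (UNIV \<times> ?S :: ('v \<times> 'e) set)" by (simp add: open_Times)
  have eq: "chart_map c' ` (chart_dom c' \<inter> chart_dom d') = UNIV \<times> ?S"
    unfolding c d by (force simp: chart_dom_lift chart_map_lift)
  have "smooth_on (UNIV \<times> ?S) (\<lambda>z::'v \<times> 'e. (fst z, ((chart_map d \<circ> chart_inv c) \<circ> snd) z))"
    by (intro smooth_on_Pair US smooth_on_compose[OF US S]
        smooth_on_linear[OF US bounded_linear_fst smooth_on_id[OF US]]
        smooth_on_linear[OF US bounded_linear_snd smooth_on_id[OF US]])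
      (use smooth_transition[OF c(1) d(1)] in \<open>auto simp: Int_commute\<close>)
  then show "smooth_on (chart_map c' ` (chart_dom c' \<inter> chart_dom d')) (chart_map d' \<circ> chart_inv c')"
    unfolding eq
  proof (rule smooth_on_cong[OF _ US])
    fix z assume "z \<in> (UNIV \<times> ?S :: ('v \<times> 'e) set)"
    then have "snd z \<in> chart_map c ` chart_dom c" by auto
    then show "(fst z, ((chart_map d \<circ> chart_inv c) \<circ> snd) z) = (chart_map d' \<circ> chart_inv c') z"
      using chart_inv_lift[OF is_chart[OF c(1)], of "snd z" "fst z"] unfolding c d
      by (simp add: chart_map_lift)
  qed
next
  fix p :: "'v \<times> 'm"
  show "base_chart (cylinder M) p \<in> lift_chart ` atlas M" "p \<in> chart_dom (base_chart (cylinder M) p)"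
    using base_chart[of "snd p"] by (auto simp: base_chart_cylinder chart_dom_lift mem_Times_iff)
qed

text \<open>The transition map is the identity times that of \<open>M\<close>, so its Jacobian is
  block diagonal with an identity block.\<close>

lemma coord_change_lift:
  assumes cd: "c \<in> atlas M" "d \<in> atlas M" "q \<in> chart_dom c" "q \<in> chart_dom d"
  shows "coord_change (lift_chart c) (lift_chart d) (t::'v::euclidean_space, q) (a, v) = (a, coord_change c d q v)"
proof -
  let ?S = "UNIV \<times> chart_map c ` chart_dom c :: ('v \<times> 'e) set"
  have "((\<lambda>z. (fst z, (chart_map d \<circ> chart_inv c) (snd z))) has_derivative
      (\<lambda>w. (fst w, coord_change c d q (snd w)))) (at (t, chart_map c q))"
    by (intro has_derivative_Pair has_derivative_fst has_derivative_ident
        has_derivative_compose[OF has_derivative_snd[OF has_derivative_ident]])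
      (use has_derivative_transition[OF cd] in \<open>simp add: o_def\<close>)
  then have "(chart_map (lift_chart d) \<circ> chart_inv (lift_chart c) has_derivative
      (\<lambda>w. (fst w, coord_change c d q (snd w)))) (at (t, chart_map c q))"
    by (rule has_derivative_transform_within_open[where s = ?S])
      (use cd open_lift_image in \<open>auto simp: chart_inv_lift is_chart chart_map_lift\<close>)
  then show ?thesis
    by (simp add: coord_change_def[of "lift_chart c"] chart_map_lift frechet_derivative_eqI)
qed

end

text \<open>The parameter \<open>V\<close> fixes the type of the Euclidean factor, so that the
  constructions for manifolds can be interpreted for the product at one definite type; they carry
  the prefix \<open>cyl\<close>.\<close>

locale cylinder_mfd = smooth_mfd M
  for M :: "('m::{t2_space,second_countable_topology}, 'e::euclidean_space) manifold" +
  fixes V :: "'v::euclidean_space itself"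
begin

sublocale cyl: smooth_mfd "cylinder M :: ('v \<times> 'm, 'v \<times> 'e) manifold"
  by standard (rule smooth_manifold_cylinder)

lemma tangent_coord_lift:
  "c \<in> atlas M \<Longrightarrow> q \<in> chart_dom c \<Longrightarrow>
    tangent_coord (cylinder M) (lift_chart c) (t::'v, q) w = (fst w, tangent_coord M c q (snd w))"
  using coord_change_lift[of "base_chart M q" c q t "fst w" "snd w"] base_chart[of q]
  by (simp add: tangent_coord_eq base_chart_cylinder)

lemma coord_field_lift:
  "c \<in> atlas M \<Longrightarrow> q \<in> chart_dom c \<Longrightarrow>
    cyl.coord_field (lift_chart c) w (t, q) = (fst w, coord_field c (snd w) q)"
  using coord_change_lift[of c "base_chart M q" q t "fst w" "snd w"] base_chart[of q]
  by (simp add: cyl.coord_field_def coord_field_def base_chart_cylinder)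

lemma vector_field_rep_lift:
  assumes "c \<in> atlas M" "y \<in> chart_map c ` chart_dom c"
  shows "vector_field_rep (cylinder M) (lift_chart c) X (t::'v, y) =
    (fst (X (t, chart_inv c y)), tangent_coord M c (chart_inv c y) (snd (X (t, chart_inv c y))))"
  using assms by (simp add: vector_field_rep_def chart_inv_lift is_chart tangent_coord_lift chart_inv_in)

lemma vector_field_cylinder_iff:
  "vector_field_on (cylinder M :: ('v \<times> 'm, 'v \<times> 'e) manifold) U X \<longleftrightarrow> open U \<and>
    (\<forall>c\<in>atlas M. smooth_on (chart_map (lift_chart c) ` (U \<inter> chart_dom (lift_chart c)))
      (vector_field_rep (cylinder M) (lift_chart c) X))"
  by (simp add: vector_field_on_def atlas_cylinder)

lemma lift_image:
  assumes "c \<in> atlas M" "open (U :: ('v \<times> 'm) set)"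
  shows "open (chart_map (lift_chart c) ` (U \<inter> chart_dom (lift_chart c)))"
    and "z \<in> chart_map (lift_chart c) ` (U \<inter> chart_dom (lift_chart c)) \<Longrightarrow> snd z \<in> chart_map c ` chart_dom c"
  using cyl.open_image[of "lift_chart c" U] assms
  by (auto simp: atlas_cylinder chart_dom_lift chart_map_lift)

section \<open>The endomorphism 0 \<oplus> \<phi>\<close>

definition lift_endo :: "('m \<Rightarrow> 'e \<Rightarrow> 'e) \<Rightarrow> 'v \<times> 'm \<Rightarrow> 'v \<times> 'e \<Rightarrow> 'v \<times> 'e" where
  "lift_endo \<phi> p w = (0, \<phi> (snd p) (snd w))"

lemma endo_rep_lift:
  assumes "c \<in> atlas M" "y \<in> chart_map c ` chart_dom c"
  shows "cyl.endo_rep (lift_endo \<phi>) (lift_chart c) (t, y) w = (0, endo_rep \<phi> c y (snd w))"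
  unfolding cyl.endo_rep_def endo_rep_def vector_field_rep_lift[OF assms]
  using assms by (simp add: lift_endo_def coord_field_lift vector_field_rep_def chart_inv_in is_chart)

text \<open>A field on the product is not a field on \<open>M\<close>, so smoothness of \<phi>
  enters through its components \<open>endo_rep\<close>: they are smooth functions of
  \<open>snd z\<close> and act on the second component of the field.\<close>

lemma smooth_endomorphism_lift:
  assumes \<phi>: "smooth_endomorphism M \<phi>"
  shows "smooth_endomorphism (cylinder M) (lift_endo \<phi>)"
  unfolding smooth_endomorphism_def
proof (intro conjI allI impI)
  fix p :: "'v \<times> 'm"
  have L: "linear (\<phi> (snd p))" using \<phi> by (simp add: smooth_endomorphism_def)
  show "linear (lift_endo \<phi> p)"
    by (rule linearI) (simp_all add: lift_endo_def linear_add[OF L] linear_scale[OF L])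
next
  fix U and X :: "'v \<times> 'm \<Rightarrow> 'v \<times> 'e" assume X: "vector_field_on (cylinder M) U X"
  show "vector_field_on (cylinder M) U (\<lambda>p. lift_endo \<phi> p (X p))"
    unfolding vector_field_cylinder_iff
  proof (intro conjI ballI)
    show U: "open U" using X by (simp add: vector_field_on_def)
    fix c assume c: "c \<in> atlas M"
    let ?S = "chart_map (lift_chart c) ` (U \<inter> chart_dom (lift_chart c))"
    let ?r = "vector_field_rep (cylinder M) (lift_chart c)"
    note S = lift_image[OF c U]
    have rX: "smooth_on ?S (?r X)" using X c by (simp add: vector_field_cylinder_iff)
    have "smooth_on ?S (\<lambda>z. endo_rep \<phi> c (snd z) (snd (?r X z)))"
    proof (rule smooth_on_linear_family[OF S(1), of "\<lambda>z. endo_rep \<phi> c (snd z)"])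
      show "linear (endo_rep \<phi> c (snd z))" if "z \<in> ?S" for z
        by (rule endo_rep_linear[OF \<phi> c S(2)[OF that]])
      have proj: "smooth_on ?S snd"
        using smooth_on_linear[OF S(1) bounded_linear_snd smooth_on_id[OF S(1)]] by simp
      have "smooth_on ?S ((\<lambda>y. endo_rep \<phi> c y v) \<circ> snd)" for v
        by (rule smooth_on_compose[OF S(1) _ _ proj endo_rep_smooth[OF \<phi> c]])
          (use open_image[OF c, of UNIV] S(2) in auto)
      then show "smooth_on ?S (\<lambda>z. endo_rep \<phi> c (snd z) v)" for v by (simp add: o_def)
      show "smooth_on ?S (\<lambda>z. snd (?r X z))" by (rule smooth_on_linear[OF S(1) bounded_linear_snd rX])
    qed
    then have "smooth_on ?S (\<lambda>z. (0::'v, endo_rep \<phi> c (snd z) (snd (?r X z))))"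
      by (intro smooth_on_Pair S(1) smooth_on_const)
    then show "smooth_on ?S (?r (\<lambda>p. lift_endo \<phi> p (X p)))"
    proof (rule smooth_on_cong[OF _ S(1)])
      fix z assume "z \<in> ?S"
      from S(2)[OF this] show "(0::'v, endo_rep \<phi> c (snd z) (snd (?r X z))) = ?r (\<lambda>p. lift_endo \<phi> p (X p)) z"
        using cyl.vector_field_rep_endo[of "lift_chart c" z "lift_endo \<phi>" X] c
          endo_rep_lift[OF c, of "snd z" \<phi> "fst z"]
        by (simp add: atlas_cylinder lift_chart_image mem_Times_iff)
    qed
  qed
qed

text \<open>The components are constant along the Euclidean factor, so only the second component of
  the direction contributes.\<close>

lemma endo_deriv_lift:
  assumes \<phi>: "smooth_endomorphism M \<phi>"
  shows "cyl.endo_deriv (lift_endo \<phi>) p v w = (0, endo_deriv \<phi> (snd p) (snd v) (snd w))"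
proof -
  let ?c = "base_chart M (snd p)"
  let ?S = "UNIV \<times> chart_map ?c ` chart_dom ?c :: ('v \<times> 'e) set"
  have "((\<lambda>z. (0::'v, endo_rep \<phi> ?c (snd z) (snd v))) has_derivative
      (\<lambda>w. (0, endo_deriv \<phi> (snd p) (snd v) (snd w)))) (at (fst p, chart_map ?c (snd p)))"
    by (intro has_derivative_Pair has_derivative_const
        has_derivative_compose[OF has_derivative_snd[OF has_derivative_ident]])
      (use endo_rep_has_derivative[OF \<phi>] in simp)
  then have "((\<lambda>z. cyl.endo_rep (lift_endo \<phi>) (lift_chart ?c) z v) has_derivative
      (\<lambda>w. (0, endo_deriv \<phi> (snd p) (snd v) (snd w)))) (at (fst p, chart_map ?c (snd p)))"
    by (rule has_derivative_transform_within_open[where s = ?S])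
      (use base_chart[of "snd p"] open_lift_image in \<open>auto simp: endo_rep_lift\<close>)
  then show ?thesis
    by (simp add: cyl.endo_deriv_def base_chart_cylinder chart_map_lift map_prod_def case_prod_unfold
        frechet_derivative_eqI)
qed

section \<open>Warped bilinear forms\<close>

text \<open>One shape for two tensors: with the inner product as \<open>a\<close> it is a warped
  metric with squared warping function \<open>h\<close>, and with \<open>a = 0\<close> it is the
  corresponding fundamental form.\<close>

definition lift_form ::
    "('v \<Rightarrow> 'v \<Rightarrow> real) \<Rightarrow> ('v \<Rightarrow> real) \<Rightarrow> ('m \<Rightarrow> 'e \<Rightarrow> 'e \<Rightarrow> real) \<Rightarrow> 'v \<times> 'm \<Rightarrow> 'v \<times> 'e \<Rightarrow> 'v \<times> 'e \<Rightarrow> real" where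
  "lift_form a h \<omega> p u v = a (fst u) (fst v) + h (fst p) * \<omega> (snd p) (snd u) (snd v)"

lemma form_rep_lift:
  assumes "c \<in> atlas M" "y \<in> chart_map c ` chart_dom c"
  shows "cyl.form_rep (lift_form a h \<omega>) (lift_chart c) (t, y) u v =
    a (fst u) (fst v) + h t * form_rep \<omega> c y (snd u) (snd v)"
  using assms chart_inv_in[OF is_chart]
  by (simp add: cyl.form_rep_def form_rep_def lift_form_def coord_field_lift chart_inv_lift is_chart)

lemma bilinear_lift_form:
  assumes a: "bilinear a" and \<omega>: "\<And>p. bilinear (\<omega> p)"
  shows "bilinear (lift_form a h \<omega> p)"
  unfolding bilinear_def
  by (auto intro!: linearI simp: lift_form_def bilinear_ladd[OF a] bilinear_radd[OF a] bilinear_lmul[OF a]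
      bilinear_rmul[OF a] bilinear_ladd[OF \<omega>] bilinear_radd[OF \<omega>] bilinear_lmul[OF \<omega>]
      bilinear_rmul[OF \<omega>] algebra_simps)

lemma smooth_bilinear_form_lift:
  assumes a: "bilinear a" and h: "smooth_on UNIV h" and \<omega>: "smooth_bilinear_form \<omega>"
  shows "cyl.smooth_bilinear_form (lift_form a h \<omega>)"
  unfolding cyl.smooth_bilinear_form_def
proof (intro conjI allI impI; (elim conjE)?)
  show "bilinear (lift_form a h \<omega> p)" for p
    by (intro bilinear_lift_form a) (use \<omega> in \<open>simp add: smooth_bilinear_form_def\<close>)
  fix U and X Y :: "'v \<times> 'm \<Rightarrow> 'v \<times> 'e"
  assume X: "vector_field_on (cylinder M) U X" and Y: "vector_field_on (cylinder M) U Y"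
  have U: "open U" using X by (simp add: vector_field_on_def)
  show "smooth_function_on (cylinder M) U (\<lambda>p. lift_form a h \<omega> p (X p) (Y p))"
    unfolding smooth_function_on_def atlas_cylinder ball_simps
  proof (intro ballI)
    fix c assume c: "c \<in> atlas M"
    let ?S = "chart_map (lift_chart c) ` (U \<inter> chart_dom (lift_chart c))"
    let ?r = "vector_field_rep (cylinder M) (lift_chart c)"
    note S = lift_image[OF c U]
    have rX: "smooth_on ?S (?r X)" "smooth_on ?S (?r Y)" using X Y c by (simp_all add: vector_field_cylinder_iff)
    have proj: "smooth_on ?S fst" "smooth_on ?S snd"
      using smooth_on_linear[OF S(1) bounded_linear_fst smooth_on_id[OF S(1)]]
        smooth_on_linear[OF S(1) bounded_linear_snd smooth_on_id[OF S(1)]] by simp_all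
    have h: "smooth_on ?S (\<lambda>z. h (fst z))"
      using smooth_on_compose[OF S(1) open_UNIV _ proj(1) h] by (simp add: o_def)
    have "smooth_on ?S (\<lambda>z. form_rep \<omega> c (snd z) (snd (?r X z)) (snd (?r Y z)))"
    proof (rule smooth_on_bilinear_family[OF S(1), of "\<lambda>z. form_rep \<omega> c (snd z)"])
      show "bilinear (form_rep \<omega> c (snd z))" if "z \<in> ?S" for z
        by (rule form_rep_bilinear[OF \<omega> c S(2)[OF that]])
      have "smooth_on ?S ((\<lambda>y. form_rep \<omega> c y u v) \<circ> snd)" for u v
        by (rule smooth_on_compose[OF S(1) _ _ proj(2) form_rep_smooth[OF \<omega> c]])
          (use open_image[OF c, of UNIV] S(2) in auto)
      then show "smooth_on ?S (\<lambda>z. form_rep \<omega> c (snd z) u v)" for u v by (simp add: o_def)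
    qed (intro smooth_on_linear[OF S(1) bounded_linear_snd] rX)+
    moreover have "smooth_on ?S (\<lambda>z. a (fst (?r X z)) (fst (?r Y z)))"
      using a by (intro smooth_on_bilinear[OF S(1), of a] smooth_on_linear[OF S(1) bounded_linear_fst] rX)
        (simp add: bilinear_conv_bounded_bilinear)
    ultimately have "smooth_on ?S (\<lambda>z. a (fst (?r X z)) (fst (?r Y z)) +
        h (fst z) * form_rep \<omega> c (snd z) (snd (?r X z)) (snd (?r Y z)))"
      by (intro smooth_on_add smooth_on_mult S(1) h)
    then show "smooth_on ?S ((\<lambda>p. lift_form a h \<omega> p (X p) (Y p)) \<circ> chart_inv (lift_chart c))"
    proof (rule smooth_on_cong[OF _ S(1)])
      fix z assume "z \<in> ?S"
      from S(2)[OF this] show "a (fst (?r X z)) (fst (?r Y z)) +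
          h (fst z) * form_rep \<omega> c (snd z) (snd (?r X z)) (snd (?r Y z))
          = ((\<lambda>p. lift_form a h \<omega> p (X p) (Y p)) \<circ> chart_inv (lift_chart c)) z"
        using cyl.form_rep_vector_field[of "lift_chart c" z "lift_form a h \<omega>" X Y] c
          form_rep_lift[OF c, of "snd z" a h \<omega> "fst z"]
        by (simp add: atlas_cylinder lift_chart_image mem_Times_iff)
    qed
  qed
qed

text \<open>In a lifted chart the part \<open>a\<close> is constant and \<omega> does not depend on
  the Euclidean variable. Besides the derivative of \<omega>, scaled by \<open>h\<close>, only the
  derivative of \<open>h\<close> survives.\<close>

lemma form_deriv_lift:
  assumes \<omega>: "smooth_bilinear_form \<omega>" and h: "(h has_derivative h') (at (fst p))"
  shows "cyl.form_deriv (lift_form a h \<omega>) p u v w =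
    h (fst p) * form_deriv \<omega> (snd p) (snd u) (snd v) (snd w) + h' (fst w) * \<omega> (snd p) (snd u) (snd v)"
proof -
  let ?c = "base_chart M (snd p)"
  let ?S = "UNIV \<times> chart_map ?c ` chart_dom ?c :: ('v \<times> 'e) set"
  let ?y = "chart_map ?c (snd p)"
  let ?D = "\<lambda>w. h (fst p) * form_deriv \<omega> (snd p) (snd u) (snd v) (snd w)
    + h' (fst w) * form_rep \<omega> ?c ?y (snd u) (snd v)"
  have h: "((\<lambda>z. h (fst z)) has_derivative (\<lambda>w. h' (fst w))) (at (fst p, ?y))"
    by (rule has_derivative_compose[OF has_derivative_fst[OF has_derivative_ident]]) (use h in simp)
  have f: "((\<lambda>z. form_rep \<omega> ?c (snd z) (snd u) (snd v)) has_derivative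
      (\<lambda>w. form_deriv \<omega> (snd p) (snd u) (snd v) (snd w))) (at (fst p, ?y))"
    by (rule has_derivative_compose[OF has_derivative_snd[OF has_derivative_ident]])
      (use form_rep_has_derivative[OF \<omega>] in simp)
  have "((\<lambda>z. a (fst u) (fst v) + h (fst z) * form_rep \<omega> ?c (snd z) (snd u) (snd v)) has_derivative
      ?D) (at (fst p, ?y))"
    using has_derivative_add[OF has_derivative_const has_derivative_mult[OF h f]] by simp
  then have "((\<lambda>z. cyl.form_rep (lift_form a h \<omega>) (lift_chart ?c) z u v) has_derivative ?D) (at (fst p, ?y))"
    by (rule has_derivative_transform_within_open[where s = ?S])
      (use base_chart[of "snd p"] open_lift_image in \<open>auto simp: form_rep_lift\<close>)
  then show ?thesis
    by (simp add: cyl.form_deriv_def base_chart_cylinder chart_map_lift map_prod_def case_prod_unfold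
        frechet_derivative_eqI form_rep_base)
qed

lemma fst_vector_field_rep:
  "c \<in> atlas M \<Longrightarrow> snd z \<in> chart_map c ` chart_dom c \<Longrightarrow>
    fst (vector_field_rep (cylinder M) (lift_chart c) X z) = fst (X (chart_inv (lift_chart c) z))"
  for z :: "'v \<times> 'e"
  using vector_field_rep_lift[of c "snd z" X "fst z"] chart_inv_lift[OF is_chart, of c "snd z" "fst z"] by simp

section \<open>Constant forms and fields of the Euclidean factor; the two projections\<close>

lemma smooth_one_form_lift:
  fixes \<alpha> :: "'v \<Rightarrow> real"
  assumes \<alpha>: "linear \<alpha>"
  shows "smooth_one_form (cylinder M) (\<lambda>p w. \<alpha> (fst w))"
  unfolding smooth_one_form_def
proof (intro conjI allI impI)
  show "linear (\<lambda>w :: 'v \<times> 'e. \<alpha> (fst w))"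
    by (rule linearI) (simp_all add: linear_add[OF \<alpha>] linear_scale[OF \<alpha>])
  fix U and X :: "'v \<times> 'm \<Rightarrow> 'v \<times> 'e" assume X: "vector_field_on (cylinder M) U X"
  have U: "open U" using X by (simp add: vector_field_on_def)
  show "smooth_function_on (cylinder M) U (\<lambda>p. \<alpha> (fst (X p)))"
    unfolding smooth_function_on_def atlas_cylinder ball_simps
  proof (intro ballI)
    fix c assume c: "c \<in> atlas M"
    let ?S = "chart_map (lift_chart c) ` (U \<inter> chart_dom (lift_chart c))"
    let ?r = "vector_field_rep (cylinder M) (lift_chart c)"
    note S = lift_image[OF c U]
    have "smooth_on ?S (\<lambda>z. \<alpha> (fst (?r X z)))"
      using X c \<alpha> by (intro smooth_on_linear[OF S(1) bounded_linear_compose[OF _ bounded_linear_fst]])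
        (simp_all add: vector_field_cylinder_iff linear_conv_bounded_linear)
    then show "smooth_on ?S ((\<lambda>p. \<alpha> (fst (X p))) \<circ> chart_inv (lift_chart c))"
      by (rule smooth_on_cong[OF _ S(1)]) (use c S(2) in \<open>simp add: fst_vector_field_rep\<close>)
  qed
qed

text \<open>The form has constant coefficients in lifted charts, so differentiating its value on a
  field amounts to applying \<alpha> to the derivative of the field. The difference of the two terms
  is the value on the bracket.\<close>

lemma ext_deriv1_lift:
  fixes \<alpha> :: "'v \<Rightarrow> real"
  assumes \<alpha>: "linear \<alpha>" and X: "vector_field_on (cylinder M) U X"
    and Y: "vector_field_on (cylinder M) U Y" and p: "p \<in> U"
  shows "ext_deriv1 (cylinder M) (\<lambda>p w. \<alpha> (fst w)) X Y p = 0"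
proof -
  have *: "vf_apply (cylinder M) W (\<lambda>q. \<alpha> (fst (Z q))) p = \<alpha> (fst (cyl.field_deriv Z p (W p)))"
    if Z: "vector_field_on (cylinder M) U Z" for W and Z :: "'v \<times> 'm \<Rightarrow> 'v \<times> 'e"
  proof -
    let ?c = "base_chart M (snd p)" and ?b = "base_chart (cylinder M) p"
    have "((\<lambda>z. \<alpha> (fst (vector_field_rep (cylinder M) ?b Z z))) has_derivative
        (\<lambda>w. \<alpha> (fst (cyl.field_deriv Z p w)))) (at (chart_map ?b p))"
      using \<alpha> by (intro bounded_linear.has_derivative[where f = \<alpha>] has_derivative_fst
        cyl.field_has_derivative[OF Z p]) (simp add: linear_conv_bounded_linear)
    then have "((\<lambda>q. \<alpha> (fst (Z q))) \<circ> chart_inv ?b has_derivative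
        (\<lambda>w. \<alpha> (fst (cyl.field_deriv Z p w)))) (at (chart_map ?b p))"
      by (rule has_derivative_transform_within_open[OF _ cyl.base_open cyl.base_chart_image])
        (simp add: base_chart_cylinder fst_vector_field_rep base_chart lift_chart_image mem_Times_iff)
    then show ?thesis by (simp add: vf_apply_def differential_def frechet_derivative_eqI)
  qed
  show ?thesis
    by (simp add: ext_deriv1_def *[OF X] *[OF Y] cyl.lie_bracket_eq linear_diff[OF \<alpha>])
qed

lemma vector_field_on_const: "vector_field_on (cylinder M) UNIV (\<lambda>p. (a :: 'v, 0))"
  unfolding vector_field_cylinder_iff
proof (intro conjI ballI open_UNIV)
  fix c assume c: "c \<in> atlas M"
  note S = lift_image[OF c open_UNIV]
  show "smooth_on (chart_map (lift_chart c) ` (UNIV \<inter> chart_dom (lift_chart c)))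
      (vector_field_rep (cylinder M) (lift_chart c) (\<lambda>p. (a, 0)))"
  proof (rule smooth_on_cong[OF smooth_on_const[OF S(1), of "(a, 0)"] S(1)])
    fix z :: "'v \<times> 'e" assume "z \<in> chart_map (lift_chart c) ` (UNIV \<inter> chart_dom (lift_chart c))"
    from S(2)[OF this] show "(a, 0) = vector_field_rep (cylinder M) (lift_chart c) (\<lambda>p. (a, 0)) z"
      using vector_field_rep_lift[OF c, of "snd z" "\<lambda>p. (a, 0)" "fst z"]
        linear_0[OF tangent_coord_linear[OF c chart_inv_in[OF is_chart[OF c]]], of "snd z"] by simp
  qed
qed

lemma differential_fst:
  fixes \<alpha> :: "'v \<Rightarrow> real"
  assumes \<alpha>: "linear \<alpha>"
  shows "differential (cylinder M) (\<lambda>q. \<alpha> (fst q)) p w = \<alpha> (fst w)"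
proof -
  let ?c = "base_chart M (snd p)" and ?b = "base_chart (cylinder M) p"
  have "((\<lambda>z :: 'v \<times> 'e. \<alpha> (fst z)) has_derivative (\<lambda>w. \<alpha> (fst w))) (at (chart_map ?b p))"
    using \<alpha> by (intro bounded_linear.has_derivative[where f = \<alpha>] has_derivative_fst has_derivative_ident)
      (simp add: linear_conv_bounded_linear)
  then have "((\<lambda>q. \<alpha> (fst q)) \<circ> chart_inv ?b has_derivative (\<lambda>w. \<alpha> (fst w))) (at (chart_map ?b p))"
    by (rule has_derivative_transform_within_open[OF _ cyl.base_open cyl.base_chart_image])
      (auto simp: base_chart_cylinder lift_chart_image chart_inv_lift is_chart base_chart)
  then show ?thesis by (simp add: differential_def frechet_derivative_eqI)
qed

text \<open>In base charts the projection is literally \<open>snd\<close>, because the base chart of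
  the product at \<open>p\<close> lifts that of \<open>M\<close> at \<open>snd p\<close>.\<close>

lemma tangent_map_snd: "tangent_map (cylinder M) M snd (p :: 'v \<times> 'm) w = snd w"
proof -
  let ?c = "base_chart M (snd p)" and ?b = "base_chart (cylinder M) p"
  have "((\<lambda>z :: 'v \<times> 'e. snd z) has_derivative (\<lambda>w. snd w)) (at (chart_map ?b p))"
    by (intro has_derivative_snd has_derivative_ident)
  then have "(chart_map ?c \<circ> snd \<circ> chart_inv ?b has_derivative (\<lambda>w. snd w)) (at (chart_map ?b p))"
    by (rule has_derivative_transform_within_open[OF _ cyl.base_open cyl.base_chart_image])
      (auto simp: base_chart_cylinder lift_chart_image chart_inv_lift chart_map_inv chart_inv_map is_chart base_chart)
  then show ?thesis by (simp add: tangent_map_def frechet_derivative_eqI)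
qed

end

section \<open>The generalized Kenmotsu structure on the warped product\<close>

lemma linear_vec_nth: "linear (\<lambda>x :: real ^ 's. x $ i)"
  by (rule linearI) simp_all

theorem theorem2p9:
  fixes F :: "('m::{t2_space,second_countable_topology}, 'e::euclidean_space) manifold"
    and J :: "'m \<Rightarrow> 'e \<Rightarrow> 'e" and G :: "'m \<Rightarrow> 'e \<Rightarrow> 'e \<Rightarrow> real"
    and n :: nat and k :: real and f :: "real ^ 's \<Rightarrow> real"
  assumes "1 \<le> n" and "DIM('e) = 2 * n"
    and "kaehler_manifold F J G"
    and "k \<noteq> 0"
    and "f = (\<lambda>t. k * exp (\<Sum>i\<in>UNIV. t $ i))"
  shows "\<exists>(\<phi> :: (real ^ 's) \<times> 'm \<Rightarrow> (real ^ 's) \<times> 'e \<Rightarrow> (real ^ 's) \<times> 'e)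
           (\<xi> :: 's \<Rightarrow> (real ^ 's) \<times> 'm \<Rightarrow> (real ^ 's) \<times> 'e)
           (\<eta> :: 's \<Rightarrow> (real ^ 's) \<times> 'm \<Rightarrow> (real ^ 's) \<times> 'e \<Rightarrow> real).
           generalized_kenmotsu_manifold n (prod_manifold euclidean_manifold F)
             \<phi> \<xi> \<eta> (warped_metric F f G)"
proof -
  have J: "smooth_endomorphism F J" and G: "riemannian_metric F G" and F: "smooth_manifold F"
    and JJ: "\<And>p u. J p (J p u) = - u" and GJ: "\<And>p u v. G p (J p u) (J p v) = G p u v"
    and torsion: "\<And>U X Y p. vector_field_on F U X \<Longrightarrow> vector_field_on F U Y \<Longrightarrow> p \<in> U \<Longrightarrow>
        nijenhuis F J X Y p = 0"
    and closed: "\<And>U X Y Z p. vector_field_on F U X \<Longrightarrow> vector_field_on F U Y \<Longrightarrow>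
        vector_field_on F U Z \<Longrightarrow> p \<in> U \<Longrightarrow> ext_deriv2 F (fundamental_form G J) X Y Z p = 0"
    using assms(3) unfolding kaehler_manifold_def by simp_all
  interpret cylinder_mfd F "TYPE(real ^ 's)" by unfold_locales (rule F)
  let ?P = "cylinder F :: ((real ^ 's) \<times> 'm, (real ^ 's) \<times> 'e) manifold"
  let ?\<phi> = "lift_endo J"
  let ?\<xi> = "\<lambda>(i::'s) (p :: (real ^ 's) \<times> 'm). (axis i (1::real), 0 :: 'e)"
  let ?\<eta> = "\<lambda>(i::'s) (p :: (real ^ 's) \<times> 'm) (w :: (real ^ 's) \<times> 'e). fst w $ i"
  let ?h = "\<lambda>t. (f t)\<^sup>2" and ?\<Omega> = "fundamental_form G J"
  let ?g = "lift_form (\<bullet>) ?h G" and ?\<Phi> = "lift_form (\<lambda>_ _. 0) ?h ?\<Omega>"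
  have bG: "bilinear (G q)" and sG: "G q u v = G q v u" and pG: "u \<noteq> 0 \<Longrightarrow> G q u u > 0" for q u v
    using G by (simp_all add: riemannian_metric_def)
  have lJ: "linear (J q)" for q using J by (simp add: smooth_endomorphism_def)
  have skew: "?\<Omega> q u v = - ?\<Omega> q v u" for q u v
    unfolding fundamental_form_def
    by (rule hermitian_form_skew[where J = "J q", OF bG]) (rule sG, rule JJ, rule GJ)
  have \<Omega>: "smooth_bilinear_form ?\<Omega>" by (rule smooth_bilinear_form_fundamental[OF G J])
  have \<Omega>_closed: "form_deriv ?\<Omega> q v w u + form_deriv ?\<Omega> q w u v + form_deriv ?\<Omega> q u v w = 0" for q u v w
    by (rule closed_form_deriv[OF \<Omega> skew]) (rule closed)
  have J_torsion: "endo_deriv J q v (J q u) - endo_deriv J q u (J q v)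
      + J q (endo_deriv J q u v) - J q (endo_deriv J q v u) = 0" for q u v
    by (rule torsion_free_endo_deriv[OF J]) (rule torsion)
  have fpos: "f t \<noteq> 0" for t using assms(4,5) by simp
  \<comment> \<open>Squaring doubles the exponent; this 2 becomes the factor in dh = 2 h \<Sum> dt_i
    and finally the one in the structure equation for the fundamental form.\<close>
  have h_eq: "?h = (\<lambda>t. k\<^sup>2 * exp (2 * (\<Sum>i\<in>UNIV. t $ i)))"
    unfolding assms(5) by (simp add: power_mult_distrib exp_double)
  have L: "bounded_linear (\<lambda>t::real ^ 's. 2 * (\<Sum>i\<in>UNIV. t $ i))"
    unfolding linear_conv_bounded_linear[symmetric]
    by (rule linearI) (simp_all add: sum.distrib sum_distrib_left algebra_simps)
  have h_smooth: "smooth_on UNIV ?h"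
    unfolding h_eq by (rule smooth_on_exp_linear[OF L])
  have h_deriv: "(?h has_derivative (\<lambda>a. 2 * ?h t * (\<Sum>i\<in>UNIV. a $ i))) (at t)" for t
  proof -
    have "((\<lambda>t. k\<^sup>2 * exp (2 * (\<Sum>i\<in>UNIV. t $ i))) has_derivative
        (\<lambda>a. k\<^sup>2 * ((2 * (\<Sum>i\<in>UNIV. a $ i)) * exp (2 * (\<Sum>i\<in>UNIV. t $ i))))) (at t)"
      by (rule has_derivative_mult_right[OF has_derivative_exp[OF bounded_linear.has_derivative[OF L has_derivative_ident]]])
    then show ?thesis unfolding h_eq by (simp add: mult_ac fun_cong[OF h_eq])
  qed
  have g_eq: "warped_metric F f G = ?g"
    by (intro ext) (simp add: warped_metric_def lift_form_def Let_def differential_fst[OF linear_vec_nth]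
        tangent_map_snd inner_vec_def)
  \<comment> \<open>The Euclidean part of the metric drops out because the values of
    \<open>lift_endo J\<close> have first component 0.\<close>
  have \<Phi>_eq: "fundamental_form ?g ?\<phi> = ?\<Phi>"
    by (intro ext) (simp add: fundamental_form_def lift_form_def lift_endo_def)
  have \<Phi>: "cyl.smooth_bilinear_form ?\<Phi>"
    by (intro smooth_bilinear_form_lift h_smooth \<Omega>) (simp add: bilinear_def linear_zero)
  have \<Phi>_skew: "?\<Phi> p u v = - ?\<Phi> p v u" for p u v
    using skew[of "snd p" "snd u"] by (simp add: lift_form_def)

  \<comment> \<open>The metric f-structure\<close>
  have "riemannian_metric ?P ?g"
    unfolding riemannian_metric_def
  proof (intro conjI allI)
    have "cyl.smooth_bilinear_form ?g"
      by (intro smooth_bilinear_form_lift h_smooth smooth_bilinear_form_metric G)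
        (simp add: bilinear_conv_bounded_bilinear bounded_bilinear_inner)
    then show "bilinear (?g p)" and "vector_field_on ?P U X \<and> vector_field_on ?P U Y \<longrightarrow>
        smooth_function_on ?P U (\<lambda>p. ?g p (X p) (Y p))" for p U X Y
      unfolding cyl.smooth_bilinear_form_def by blast+
    show "?g p u v = ?g p v u" for p u v
      by (simp add: lift_form_def inner_commute sG)
    show "u \<noteq> 0 \<longrightarrow> 0 < ?g p u u" for p u
    proof
      assume "u \<noteq> 0"
      then consider "fst u \<noteq> 0" | "snd u \<noteq> 0" by (metis prod_eq_iff fst_zero snd_zero)
      moreover have "G (snd p) (snd u) (snd u) \<ge> 0"
        using pG[of "snd u" "snd p"] bilinear_lzero[OF bG] by (cases "snd u = 0") (auto simp: less_imp_le)
      ultimately show "0 < ?g p u u"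
        unfolding lift_form_def using pG[of "snd u" "snd p"] fpos[of "fst p"]
        by cases (auto intro: add_pos_nonneg add_nonneg_pos)
    qed
  qed
  moreover have "?\<phi> p (?\<phi> p u) = - u + (\<Sum>i\<in>UNIV. ?\<eta> i p u *\<^sub>R ?\<xi> i p)" for p u
    \<comment> \<open>The sum over the \<xi> restores \<open>fst u\<close>, which cancels the first
      component of \<open>- u\<close>; the second component is the rule for the square of
      \<open>J\<close>.\<close>
    using basis_expansion[of "fst u"]
    by (simp add: lift_endo_def JJ prod_eq_iff fst_sum snd_sum scalar_mult_eq_scaleR)
  moreover have "?g p (?\<phi> p u) (?\<phi> p v) = ?g p u v - (\<Sum>i\<in>UNIV. ?\<eta> i p u * ?\<eta> i p v)" for p u v
    by (simp add: lift_form_def lift_endo_def GJ inner_vec_def)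
  moreover have "?\<eta> i p (?\<xi> j p) = (if i = j then 1 else 0)" for i j p
    by (simp add: axis_def)
  moreover have "DIM((real ^ 's) \<times> 'e) = 2 * n + CARD('s)"
    using assms(2) by simp
  ultimately have metric: "metric_f_manifold n ?P ?\<phi> ?\<xi> ?\<eta> ?g"
    unfolding metric_f_manifold_def
    using assms(1) cyl.smooth_manifold smooth_endomorphism_lift[OF J] vector_field_on_const
      smooth_one_form_lift[OF linear_vec_nth] by blast

  \<comment> \<open>Non-vanishing of the top form\<close>
  have nonzero: "\<exists>v. wedge_list (map (\<lambda>i. ?\<eta> i p) is) (2 * n) (wedge_power2 (?\<Phi> p) n) v \<noteq> 0"
    if "distinct is" for p "is"
  proof -
    obtain v where v: "symplectic_sequence (\<lambda>x y. G (snd p) x (J (snd p) y)) n v"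
      using exists_symplectic_sequence[where J = "J (snd p)", OF bG _ pG sG JJ GJ lJ, of n] assms(2) by auto
    \<comment> \<open>On vectors tangent to \<open>F\<close> the form is the Kaehler form scaled by
      the positive number \<open>(f (fst p))\<^sup>2\<close>, which keeps the sequence symplectic.
      Its vectors are annihilated by every \<eta>, as the contraction of the 1-forms
      requires.\<close>
    have "symplectic_sequence (?\<Phi> p) n (\<lambda>i. (0, v i))"
      unfolding symplectic_sequence_def
    proof (intro allI impI)
      fix i j assume "i < n" "j < n"
      from v[unfolded symplectic_sequence_def, rule_format, OF this] fpos[of "fst p"]
      show "?\<Phi> p (0, v (2 * i)) (0, v (2 * j)) = 0 \<and> ?\<Phi> p (0, v (2 * i + 1)) (0, v (2 * j + 1)) = 0 \<and>
        (if i = j then 0 < ?\<Phi> p (0, v (2 * i)) (0, v (2 * j + 1)) else ?\<Phi> p (0, v (2 * i)) (0, v (2 * j + 1)) = 0)"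
        by (simp add: lift_form_def fundamental_form_def split: if_splits)
    qed
    from wedge_power2_pos[OF \<Phi>_skew this]
    have nz: "wedge_power2 (?\<Phi> p) n (\<lambda>i. (0, v i)) \<noteq> 0" by simp
    have "wedge_list (map (\<lambda>i. ?\<eta> i p) is) (2 * n) (wedge_power2 (?\<Phi> p) n)
        (\<lambda>i. if i < length is then ?\<xi> (is ! i) p else (0, v (i - length is))) \<noteq> 0"
      by (rule wedge_list_nonzero[OF alternating_form_wedge_power2 nz _ _ that]) (auto simp: axis_def)
    then show ?thesis by blast
  qed

  \<comment> \<open>The structure equations for the exterior derivatives\<close>
  have d\<eta>: "ext_deriv1 ?P (?\<eta> i) X Y p = 0"
    if "vector_field_on ?P U X" "vector_field_on ?P U Y" "p \<in> U" for i U X Y p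
    using ext_deriv1_lift[OF linear_vec_nth that] .

  have d\<Phi>: "ext_deriv2 ?P ?\<Phi> X Y Z p =
      2 * (\<Sum>i\<in>UNIV. wedge 1 2 (form1 (?\<eta> i p)) (form2 (?\<Phi> p)) ((!) [X p, Y p, Z p]))"
    if X: "vector_field_on ?P U X" and Y: "vector_field_on ?P U Y" and Z: "vector_field_on ?P U Z" and p: "p \<in> U"
    for U X Y Z p
  proof -
    let ?s = "\<lambda>u. \<Sum>i\<in>UNIV. fst u $ i"
    have "ext_deriv2 ?P ?\<Phi> X Y Z p =
        (2 / 3) * (?s (X p) * ?\<Phi> p (Y p) (Z p) + ?s (Y p) * ?\<Phi> p (Z p) (X p) + ?s (Z p) * ?\<Phi> p (X p) (Y p))"
      unfolding cyl.ext_deriv2_eq[OF \<Phi> \<Phi>_skew X Y Z p] form_deriv_lift[OF \<Omega> h_deriv]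
      \<comment> \<open>Closedness of the Kaehler form, multiplied by \<open>?h\<close>, removes the
        derivatives of its components. The derivative of \<open>?h\<close> contributes
        \<open>2 * ?s\<close> times the fundamental form in each cyclic term, and the 1/3 comes from
        the normalisation of the exterior derivative.\<close>
      using arg_cong[where f = "\<lambda>x. ?h (fst p) * x", OF \<Omega>_closed[of "snd p" "snd (Y p)" "snd (Z p)" "snd (X p)"]]
      by (simp add: lift_form_def algebra_simps)
    also have "\<dots> = 2 * (\<Sum>i\<in>UNIV. wedge 1 2 (form1 (?\<eta> i p)) (form2 (?\<Phi> p)) ((!) [X p, Y p, Z p]))"
      \<comment> \<open>Each wedge product is one third of a cyclic sum, so summing over the indices
        and doubling gives the factor \<open>2 / 3\<close>.\<close>
      unfolding wedge_one_two_form[of "?\<Phi> p", OF \<Phi>_skew]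
      by (simp add: sum_divide_distrib[symmetric] sum.distrib sum_distrib_right)
    finally show ?thesis .
  qed

  \<comment> \<open>Normality\<close>
  have normal: "normal_structure ?P ?\<phi> ?\<xi> ?\<eta>"
    unfolding normal_structure_def
  proof (intro allI impI ballI; elim conjE)
    fix U X Y p assume X: "vector_field_on ?P U X" and Y: "vector_field_on ?P U Y" and p: "p \<in> U"
    \<comment> \<open>The first component is 0, and the second is the pointwise torsion identity for
      \<open>J\<close> at the second components of the values of \<open>X\<close> and
      \<open>Y\<close>.\<close>
    have "nijenhuis ?P ?\<phi> X Y p = 0"
      unfolding cyl.nijenhuis_eq[OF smooth_endomorphism_lift[OF J] X Y p] endo_deriv_lift[OF J]
      using J_torsion[of "snd p" "snd (Y p)" "snd (X p)"]
      by (simp add: lift_endo_def zero_prod_def)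
    then show "nijenhuis ?P ?\<phi> X Y p + 2 *\<^sub>R (\<Sum>i\<in>UNIV. ext_deriv1 ?P (?\<eta> i) X Y p *\<^sub>R ?\<xi> i p) = 0"
      by (simp add: d\<eta>[OF X Y p] sum_prod zero_prod_def)
  qed
  have "generalized_kenmotsu_manifold n ?P ?\<phi> ?\<xi> ?\<eta> (warped_metric F f G)"
    unfolding generalized_kenmotsu_manifold_def generalized_almost_kenmotsu_manifold_def
      almost_s_contact_metric_manifold_def g_eq \<Phi>_eq
    using metric nonzero d\<eta> d\<Phi> normal by blast
  then show ?thesis by blast
qed

end
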